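(* If $r\geq 2$ and $\mathfrak{g}=\mathfrak{so}_{2r+1}(\mathbb{C})$, with $\tilde{\alpha}=\alpha_1+\cdots+\alpha_r$ the sum of all simple roots, then $|\mathcal{CA}(\tilde{\alpha},0)|=F_{r+1}$.
   Context: Let $W$ be the Weyl group of $\mathfrak{g}$, generated by the simple reflections $s_1,\dots,s_r$, and $\rho$ half the sum of the positive roots. Kostant's partition function $\wp(\xi)$ is the number of ways to write $\xi\in\mathfrak{h}^*$ as a nonnegative integral sum of positive roots. For integral weights $\lambda,\mu$, the Weyl alternation set is $\mathcal{A}(\lambda,\mu)=\{\sigma\in W:\wp(\sigma(\lambda+\rho)-(\mu+\rho))>0\}$, and the collapsed Weyl alternation set is $$\mathcal{CA}(\lambda,\mu)=\{\sigma\in\mathcal{A}(\lambda,\mu): \text{there is no simple reflection } s_i\in W \text{ with } \wp(\sigma(\lambda+\rho)-\rho-\mu)=\wp(\sigma s_i(\lambda+\rho)-\rho-\mu)\}.$$ $F_n$ denotes the $n$-th Fibonacci number: $F_0=0$, $F_1=1$, $F_n=F_{n-1}+F_{n-2}$. *)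

theory Defs
  imports
    "Jordan_Normal_Form.Matrix"
    "HOL-Library.Function_Algebras"
    "HOL-Number_Theory.Fib"
begin

text \<open>
  The Lie algebra \<open>so(2r+1, C)\<close> is realised on \<open>C^(2r+1)\<close> as the Lie algebra of the symmetric
  form with anti-diagonal Gram matrix (all non-degenerate symmetric forms over \<open>C\<close> are equivalent),
  for which the diagonal matrices in it form a Cartan subalgebra. Matrix and vector indices,
  and hence also the indices of simple roots, start at 0.
\<close>

definition form_mat :: "nat \<Rightarrow> complex mat" where
  "form_mat r = mat (2 * r + 1) (2 * r + 1) (\<lambda>(i, j). if i + j = 2 * r then 1 else 0)"

definition so_odd :: "nat \<Rightarrow> complex mat set" where
  "so_odd r = {X \<in> carrier_mat (2 * r + 1) (2 * r + 1).
     X\<^sup>T * form_mat r + form_mat r * X = 0\<^sub>m (2 * r + 1) (2 * r + 1)}"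

definition cartan :: "nat \<Rightarrow> complex mat set" where
  "cartan r = {H \<in> so_odd r. diagonal_mat H}"

text \<open>
  The elements of \<open>cartan r\<close> are the matrices
  \<open>diag(h 0, \<dots>, h (r-1), 0, - h (r-1), \<dots>, - h 0)\<close>, so the functionals \<open>\<epsilon>\<^sub>i H = H $$ (i, i)\<close>,
  \<open>i < r\<close>, form a basis of the dual of the Cartan subalgebra. A weight is represented by its
  coordinates in this basis; coordinates with index \<open>\<ge> r\<close> are 0. Addition, subtraction and 0
  of weights are the pointwise ones.
\<close>

type_synonym weight = "nat \<Rightarrow> complex"

definition dual_cartan :: "nat \<Rightarrow> weight set" where
  "dual_cartan r = {\<xi>. \<forall>j\<ge>r. \<xi> j = 0}"

definition weight_apply :: "nat \<Rightarrow> weight \<Rightarrow> complex mat \<Rightarrow> complex" where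
  "weight_apply r \<xi> H = (\<Sum>i<r. \<xi> i * H $$ (i, i))"

definition weight_scale :: "complex \<Rightarrow> weight \<Rightarrow> weight" (infixr "*\<^sub>w" 75) where
  "c *\<^sub>w \<xi> = (\<lambda>j. c * \<xi> j)"

definition root_space :: "nat \<Rightarrow> weight \<Rightarrow> complex mat set" where
  "root_space r \<alpha> = {X \<in> so_odd r. \<forall>H\<in>cartan r. H * X - X * H = weight_apply r \<alpha> H \<cdot>\<^sub>m X}"

definition roots :: "nat \<Rightarrow> weight set" where
  "roots r = {\<alpha> \<in> dual_cartan r. \<alpha> \<noteq> 0 \<and> root_space r \<alpha> \<noteq> {0\<^sub>m (2 * r + 1) (2 * r + 1)}}"

definition eps :: "nat \<Rightarrow> weight" where
  "eps i = (\<lambda>j. if j = i then 1 else 0)"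

text \<open>\<open>simple_root r 0, \<dots>, simple_root r (r - 1)\<close> are the simple roots
  \<open>\<alpha>\<^sub>1, \<dots>, \<alpha>\<^sub>r\<close>; the last one is the short one.\<close>

definition simple_root :: "nat \<Rightarrow> nat \<Rightarrow> weight" where
  "simple_root r i = (if Suc i < r then eps i - eps (Suc i) else eps i)"

definition positive_roots :: "nat \<Rightarrow> weight set" where
  "positive_roots r = {\<alpha> \<in> roots r. \<exists>c :: nat \<Rightarrow> nat. \<alpha> = (\<Sum>i<r. of_nat (c i) *\<^sub>w simple_root r i)}"

definition rho :: "nat \<Rightarrow> weight" where
  "rho r = (1 / 2) *\<^sub>w (\<Sum>\<alpha>\<in>positive_roots r. \<alpha>)"

text \<open>The symmetric bilinear form for which the \<open>\<epsilon>\<^sub>i\<close> are orthonormal is the one induced, up to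
  a scalar factor, by the Killing form.\<close>

definition weight_inner :: "nat \<Rightarrow> weight \<Rightarrow> weight \<Rightarrow> complex" where
  "weight_inner r \<xi> \<eta> = (\<Sum>j<r. \<xi> j * \<eta> j)"

definition simple_reflection :: "nat \<Rightarrow> nat \<Rightarrow> weight \<Rightarrow> weight" where
  "simple_reflection r i \<xi> =
     \<xi> - (2 * weight_inner r \<xi> (simple_root r i) / weight_inner r (simple_root r i) (simple_root r i))
         *\<^sub>w simple_root r i"

text \<open>The reflections are involutions, so closure under right multiplication by them generates
  the whole group. They fix the unused coordinates \<open>\<ge> r\<close>, so two elements of \<open>weyl_group r\<close>
  are equal as soon as they agree on \<open>dual_cartan r\<close>.\<close>

inductive_set weyl_group :: "nat \<Rightarrow> (weight \<Rightarrow> weight) set" for r :: nat where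
  one: "id \<in> weyl_group r"
| mult: "\<sigma> \<in> weyl_group r \<Longrightarrow> i < r \<Longrightarrow> \<sigma> \<circ> simple_reflection r i \<in> weyl_group r"

text \<open>A way to write \<open>\<xi>\<close> as a sum of positive roots is given by the multiplicity of each
  positive root.\<close>

definition kostant_partition :: "nat \<Rightarrow> weight \<Rightarrow> nat" where
  "kostant_partition r \<xi> = card {m :: weight \<Rightarrow> nat.
     (\<forall>\<beta>. \<beta> \<notin> positive_roots r \<longrightarrow> m \<beta> = 0) \<and>
     \<xi> = (\<Sum>\<beta>\<in>positive_roots r. of_nat (m \<beta>) *\<^sub>w \<beta>)}"

definition alternation_set :: "nat \<Rightarrow> weight \<Rightarrow> weight \<Rightarrow> (weight \<Rightarrow> weight) set" where
  "alternation_set r lam mu =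
     {\<sigma> \<in> weyl_group r. kostant_partition r (\<sigma> (lam + rho r) - (mu + rho r)) > 0}"

definition collapsed_alternation_set :: "nat \<Rightarrow> weight \<Rightarrow> weight \<Rightarrow> (weight \<Rightarrow> weight) set" where
  "collapsed_alternation_set r lam mu =
     {\<sigma> \<in> alternation_set r lam mu.
        \<not> (\<exists>i<r. kostant_partition r (\<sigma> (lam + rho r) - rho r - mu) =
                 kostant_partition r ((\<sigma> \<circ> simple_reflection r i) (lam + rho r) - rho r - mu))}"

end

theory Submission
  imports Defs "HOL-Combinatorics.Permutations"
begin

text \<open>
  Indices start at 0, and \<open>v = \<epsilon>\<^sub>0 + \<rho>\<close> denotes the shifted highest weight \<open>\<alpha>\<^sub>0 + \<dots> + \<alpha>\<^sub>r\<^sub>-\<^sub>1 + \<rho>\<close>,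
  whose coordinates are \<open>r + 1/2, r - 3/2, r - 5/2, \<dots>, 1/2\<close>. The coefficient of \<open>\<alpha>\<^sub>k\<close> in a weight \<open>\<xi>\<close>
  is the partial sum \<open>\<xi>\<^sub>0 + \<dots> + \<xi>\<^sub>k\<close>, so that \<open>\<xi>\<close> is a sum of positive roots if and only if these
  partial sums are natural numbers.

  A Weyl group element \<open>\<sigma>\<close> is a signed permutation of the coordinates. The partial sums of \<open>\<sigma> v\<close> are
  at most those of \<open>v\<close>, which exceed those of \<open>\<rho>\<close> by 1. Hence, if \<open>\<sigma>\<close> is in the alternation set, all
  simple root coefficients of \<open>\<sigma> v - \<rho>\<close> are 0 or 1, and \<open>\<sigma> v = v - \<Sum>\<^sub>j\<^sub>\<in>\<^sub>J \<alpha>\<^sub>j\<close> for the set \<open>J\<close> of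
  positions with coefficient 0. Here \<open>0 \<notin> J\<close>, since no coordinate of \<open>v\<close> is \<open>\<rho>\<^sub>0 = r - 1/2\<close> up to sign,
  and \<open>J\<close> contains no two consecutive numbers, since the coordinates of \<open>v\<close> are positive and distinct
  (\<open>alternation_orbit_point\<close>). Conversely every such \<open>J\<close> arises,
  from the product of the pairwise commuting reflections \<open>s\<^sub>j\<close>, \<open>j \<in> J\<close> (\<open>orbit_point_attained\<close>). As the
  Weyl group acts freely on \<open>v\<close> (\<open>weyl_group_free\<close>), the alternation set is in bijection with the
  subsets of \<open>{1, \<dots>, r - 1}\<close> without consecutive elements, and there are \<open>F\<^sub>r\<^sub>+\<^sub>1\<close> of these.

  It remains to see that collapsing removes nothing. Suppose that \<open>\<sigma>\<close> and \<open>\<sigma> s\<^sub>i\<close> are both in the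
  alternation set, with sets \<open>J\<close> and \<open>K\<close>. The points \<open>\<sigma> v\<close> and \<open>\<sigma> s\<^sub>i v\<close> differ by a positive multiple of
  the root \<open>\<sigma> \<alpha>\<^sub>i\<close>, whose simple root coefficients all have the same sign, so one of \<open>J\<close> and \<open>K\<close> is a
  proper subset of the other (\<open>orbit_points_comparable\<close>). If \<open>J \<subset> K\<close>, adding the simple roots
  \<open>\<alpha>\<^sub>l\<close>, \<open>l \<in> K - J\<close>, maps the partitions belonging to \<open>K\<close> injectively to those belonging to \<open>J\<close>; for
  \<open>j \<in> K - J\<close> the partition that contains the root \<open>\<alpha>\<^sub>j\<^sub>-\<^sub>1 + \<alpha>\<^sub>j\<close> in place of \<open>\<alpha>\<^sub>j\<^sub>-\<^sub>1\<close> and \<open>\<alpha>\<^sub>j\<close> is missed, so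
  the two values of the partition function differ (\<open>kostant_orbit_point_less\<close>).
\<close>

section \<open>Roots\<close>

text \<open>
  The weight of the \<open>a\<close>-th standard basis vector of \<open>C^(2r+1)\<close>, \<open>a \<le> 2 * r\<close>: it is \<open>\<epsilon>\<^sub>a\<close> for \<open>a < r\<close>,
  0 for \<open>a = r\<close> and \<open>- \<epsilon>\<^sub>2\<^sub>r\<^sub>-\<^sub>a\<close> for \<open>a > r\<close>. The roots are the differences \<open>wt r a - wt r b\<close>
  with \<open>a \<noteq> b\<close> and \<open>a + b \<noteq> 2 * r\<close>, which avoids treating the root types \<open>\<epsilon>\<^sub>i - \<epsilon>\<^sub>j\<close>, \<open>\<epsilon>\<^sub>i + \<epsilon>\<^sub>j\<close>
  and \<open>\<epsilon>\<^sub>i\<close> separately.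
\<close>

definition wt :: "nat \<Rightarrow> nat \<Rightarrow> weight" where
  "wt r a = (\<lambda>j. if j < r then of_bool (j = a) - of_bool (j + a = 2 * r) else 0)"

lemma wt_opposite: "a \<le> 2 * r \<Longrightarrow> wt r (2 * r - a) = - wt r a"
  by (auto simp: wt_def fun_eq_iff)

lemma wt_middle: "wt r r = 0"
  by (auto simp: wt_def fun_eq_iff)

lemma wt_eq_eps: "a < r \<Longrightarrow> wt r a = eps a"
  by (auto simp: wt_def eps_def fun_eq_iff)

lemma wt_dual_cartan: "wt r a \<in> dual_cartan r"
  by (auto simp: wt_def dual_cartan_def)

lemma wt_inj:
  assumes "a \<le> 2 * r" "b \<le> 2 * r" "wt r a = wt r b"
  shows "a = b"
proof -
  have low: "c = d" if "c < r" "wt r c = wt r d" for c d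
  proof -
    have "wt r c c = wt r d c" using that by simp
    then show ?thesis using that(1) by (simp add: wt_def of_bool_def split: if_splits)
  qed
  have high: "c = d" if "r < c" "c \<le> 2 * r" "d \<le> 2 * r" "wt r c = wt r d" for c d
  proof -
    have "2 * r - c = 2 * r - d"
      using that by (intro low) (auto simp: wt_opposite)
    then show ?thesis using that by linarith
  qed
  show ?thesis
    using low[of a b] low[of b a] high[of a b] high[of b a] assms by fastforce
qed

text \<open>The defining condition says that the matrix is skew under reflection in the anti-diagonal.\<close>

lemma so_odd_iff:
  "X \<in> so_odd r \<longleftrightarrow> X \<in> carrier_mat (2 * r + 1) (2 * r + 1) \<and>
     (\<forall>i\<le>2 * r. \<forall>j\<le>2 * r. X $$ (i, j) = - X $$ (2 * r - j, 2 * r - i))"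
proof (cases "X \<in> carrier_mat (2 * r + 1) (2 * r + 1)")
  case True
  let ?n = "2 * r + 1"
  let ?Z = "X\<^sup>T * form_mat r + form_mat r * X"
  have entry: "?Z $$ (i, j) = X $$ (2 * r - j, i) + X $$ (2 * r - i, j)"
    if "i < ?n" "j < ?n" for i j
  proof -
    have "(X\<^sup>T * form_mat r) $$ (i, j) = (\<Sum>k = 0..<?n. X $$ (k, i) * (if k + j = 2 * r then 1 else 0))"
      using True that by (auto simp: scalar_prod_def form_mat_def intro!: sum.cong)
    also have "\<dots> = (\<Sum>k = 0..<?n. if k = 2 * r - j then X $$ (k, i) else 0)"
      using that by (intro sum.cong) auto
    also have "\<dots> = X $$ (2 * r - j, i)"
      by (subst sum.delta) auto
    finally have 1: "(X\<^sup>T * form_mat r) $$ (i, j) = X $$ (2 * r - j, i)" .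
    have "(form_mat r * X) $$ (i, j) = (\<Sum>k = 0..<?n. (if i + k = 2 * r then 1 else 0) * X $$ (k, j))"
      using True that by (auto simp: scalar_prod_def form_mat_def intro!: sum.cong)
    also have "\<dots> = (\<Sum>k = 0..<?n. if k = 2 * r - i then X $$ (k, j) else 0)"
      using that by (intro sum.cong) auto
    also have "\<dots> = X $$ (2 * r - i, j)"
      by (subst sum.delta) auto
    finally have 2: "(form_mat r * X) $$ (i, j) = X $$ (2 * r - i, j)" .
    show ?thesis
      using 1 2 True that by (simp add: form_mat_def)
  qed
  have "?Z = 0\<^sub>m ?n ?n \<longleftrightarrow> (\<forall>i<?n. \<forall>j<?n. ?Z $$ (i, j) = 0)"
    using True by (auto simp: mat_eq_iff form_mat_def simp del: index_mult_mat(1) index_add_mat(1))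
  also have "\<dots> \<longleftrightarrow> (\<forall>i<?n. \<forall>j<?n. X $$ (2 * r - j, i) + X $$ (2 * r - i, j) = 0)"
    using entry by metis
  also have "\<dots> \<longleftrightarrow> (\<forall>i\<le>2 * r. \<forall>j\<le>2 * r. X $$ (i, j) = - X $$ (2 * r - j, 2 * r - i))"
  proof (intro iffI allI impI)
    fix i j assume *: "\<forall>i<?n. \<forall>j<?n. X $$ (2 * r - j, i) + X $$ (2 * r - i, j) = 0"
      and ij: "i \<le> 2 * r" "j \<le> 2 * r"
    have "X $$ (2 * r - j, 2 * r - i) + X $$ (2 * r - (2 * r - i), j) = 0"
      by (rule *[rule_format]) (use ij in auto)
    then show "X $$ (i, j) = - X $$ (2 * r - j, 2 * r - i)"
      using ij by (simp add: eq_neg_iff_add_eq_0 add.commute)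
  next
    fix i j assume *: "\<forall>i\<le>2 * r. \<forall>j\<le>2 * r. X $$ (i, j) = - X $$ (2 * r - j, 2 * r - i)"
      and ij: "i < ?n" "j < ?n"
    have "X $$ (2 * r - i, j) = - X $$ (2 * r - j, 2 * r - (2 * r - i))"
      by (rule *[rule_format]) (use ij in auto)
    then show "X $$ (2 * r - j, i) + X $$ (2 * r - i, j) = 0"
      using ij by simp
  qed
  finally show ?thesis
    using True by (simp add: so_odd_def)
qed (simp add: so_odd_def)

lemma cartan_carrier: "H \<in> cartan r \<Longrightarrow> H \<in> carrier_mat (2 * r + 1) (2 * r + 1)"
  by (simp add: cartan_def so_odd_iff)

lemma cartan_entry:
  assumes "H \<in> cartan r" "a \<le> 2 * r"
  shows "H $$ (a, a) = weight_apply r (wt r a) H"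
proof -
  have skew: "H $$ (i, i) = - H $$ (2 * r - i, 2 * r - i)" if "i \<le> 2 * r" for i
    using assms that unfolding cartan_def so_odd_iff by blast
  have "weight_apply r (wt r a) H
      = (\<Sum>i<r. (if i = a then H $$ (i, i) else 0) - (if i = 2 * r - a then H $$ (i, i) else 0))"
    unfolding weight_apply_def wt_def using assms(2) by (intro sum.cong) auto
  also have "\<dots> = (if a < r then H $$ (a, a) else 0)
      - (if 2 * r - a < r then H $$ (2 * r - a, 2 * r - a) else 0)"
    by (simp add: sum_subtractf)
  also have "\<dots> = H $$ (a, a)"
  proof -
    consider "a < r" | "a = r" | "a > r" by linarith
    then show ?thesis
    proof cases
      case 2
      have "2 * r - r = r" by simp
      then have "H $$ (r, r) + H $$ (r, r) = 0"
        using skew[of r] unfolding eq_neg_iff_add_eq_0 by simp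
      then show ?thesis using 2 by simp
    qed (use skew[of a] assms(2) in auto)
  qed
  finally show ?thesis ..
qed

lemma bracket_cartan_entry:
  assumes "H \<in> cartan r" "X \<in> carrier_mat (2 * r + 1) (2 * r + 1)" "a \<le> 2 * r" "b \<le> 2 * r"
  shows "(H * X - X * H) $$ (a, b) = weight_apply r (wt r a - wt r b) H * X $$ (a, b)"
proof -
  let ?n = "2 * r + 1"
  have H: "H \<in> carrier_mat ?n ?n" and diag: "\<And>i j. i < ?n \<Longrightarrow> j < ?n \<Longrightarrow> i \<noteq> j \<Longrightarrow> H $$ (i, j) = 0"
    using assms(1) cartan_carrier[OF assms(1)] by (auto simp: cartan_def diagonal_mat_def)
  have "(H * X) $$ (a, b) = (\<Sum>k = 0..<?n. H $$ (a, k) * X $$ (k, b))"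
    using H assms by (auto simp: scalar_prod_def intro!: sum.cong)
  also have "\<dots> = (\<Sum>k = 0..<?n. if k = a then H $$ (a, a) * X $$ (a, b) else 0)"
    using assms diag by (intro sum.cong) auto
  finally have 1: "(H * X) $$ (a, b) = H $$ (a, a) * X $$ (a, b)"
    using assms by simp
  have "(X * H) $$ (a, b) = (\<Sum>k = 0..<?n. X $$ (a, k) * H $$ (k, b))"
    using H assms by (auto simp: scalar_prod_def intro!: sum.cong)
  also have "\<dots> = (\<Sum>k = 0..<?n. if k = b then X $$ (a, b) * H $$ (b, b) else 0)"
    using assms diag by (intro sum.cong) auto
  finally have 2: "(X * H) $$ (a, b) = X $$ (a, b) * H $$ (b, b)"
    using assms by simp
  have "weight_apply r (wt r a - wt r b) H = H $$ (a, a) - H $$ (b, b)"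
    using assms cartan_entry[of H r]
    by (simp add: weight_apply_def sum_subtractf left_diff_distrib)
  then have "weight_apply r (wt r a - wt r b) H * X $$ (a, b) = (H * X) $$ (a, b) - (X * H) $$ (a, b)"
    using 1 2 by (simp only: left_diff_distrib mult.commute[of "X $$ (a, b)"])
  then show ?thesis
    using H assms by simp
qed

lemma weight_eqI:
  assumes "\<alpha> \<in> dual_cartan r" "\<beta> \<in> dual_cartan r"
    and eq: "\<And>H. H \<in> cartan r \<Longrightarrow> weight_apply r \<alpha> H = weight_apply r \<beta> H"
  shows "\<alpha> = \<beta>"
proof
  fix i
  show "\<alpha> i = \<beta> i"
  proof (cases "i < r")
    case True
    \<comment> \<open>the element of the Cartan subalgebra dual to \<open>\<epsilon>\<^sub>i\<close>\<close>
    define H :: "complex mat" where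
      "H = mat (2 * r + 1) (2 * r + 1) (\<lambda>(a, b). if a = b then wt r a i else 0)"
    have "H \<in> cartan r"
      using True by (auto simp: cartan_def so_odd_iff H_def diagonal_mat_def wt_opposite)
    moreover have "weight_apply r \<xi> H = \<xi> i" for \<xi>
    proof -
      have "weight_apply r \<xi> H = (\<Sum>j<r. if j = i then \<xi> i else 0)"
        unfolding weight_apply_def H_def using True by (intro sum.cong) (auto simp: wt_def)
      then show ?thesis using True by simp
    qed
    ultimately show ?thesis using eq by metis
  qed (use assms in \<open>auto simp: dual_cartan_def\<close>)
qed

lemma roots_eq: "roots r = {wt r a - wt r b | a b. a \<le> 2 * r \<and> b \<le> 2 * r \<and> a \<noteq> b \<and> a + b \<noteq> 2 * r}"
    (is "_ = ?R")
proof (intro equalityI subsetI)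
  let ?n = "2 * r + 1"
  fix \<alpha> assume \<alpha>: "\<alpha> \<in> roots r"
  have "0\<^sub>m ?n ?n \<in> root_space r \<alpha>"
  proof -
    have "H * 0\<^sub>m ?n ?n - 0\<^sub>m ?n ?n * H = weight_apply r \<alpha> H \<cdot>\<^sub>m 0\<^sub>m ?n ?n" if "H \<in> cartan r" for H
      using cartan_carrier[OF that] by simp
    then show ?thesis by (auto simp: root_space_def so_odd_iff)
  qed
  with \<alpha> obtain X where X: "X \<in> root_space r \<alpha>" "X \<noteq> 0\<^sub>m ?n ?n"
    by (auto simp: roots_def)
  have Xso: "X \<in> so_odd r" and Xc: "X \<in> carrier_mat ?n ?n"
    using X unfolding root_space_def so_odd_iff by blast+
  from X(2) Xc obtain a b where ab: "a \<le> 2 * r" "b \<le> 2 * r" "X $$ (a, b) \<noteq> 0"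
    by (auto simp: mat_eq_iff less_Suc_eq_le)
  have \<alpha>_eq: "\<alpha> = wt r a - wt r b"
  proof (rule weight_eqI)
    show "\<alpha> \<in> dual_cartan r" using \<alpha> by (simp add: roots_def)
    show "wt r a - wt r b \<in> dual_cartan r"
      using wt_dual_cartan[of r a] wt_dual_cartan[of r b] by (simp add: dual_cartan_def)
    fix H assume H: "H \<in> cartan r"
    then have "(H * X - X * H) $$ (a, b) = (weight_apply r \<alpha> H \<cdot>\<^sub>m X) $$ (a, b)"
      using X by (simp add: root_space_def)
    then show "weight_apply r \<alpha> H = weight_apply r (wt r a - wt r b) H"
      using bracket_cartan_entry[OF H Xc ab(1,2)] ab Xc by simp
  qed
  \<comment> \<open>The entries on the anti-diagonal vanish, so \<open>wt r a - wt r (2 * r - a)\<close> does not occur as a root.\<close>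
  have "a \<noteq> b" using \<alpha> \<alpha>_eq by (auto simp: roots_def)
  moreover have "a + b \<noteq> 2 * r"
  proof
    assume "a + b = 2 * r"
    then have "X $$ (a, b) = - X $$ (a, b)"
      using Xso ab unfolding so_odd_iff by (metis add_diff_cancel_left' add_diff_cancel_right')
    with ab show False unfolding eq_neg_iff_add_eq_0 by simp
  qed
  ultimately show "\<alpha> \<in> ?R" using \<alpha>_eq ab by blast
next
  let ?n = "2 * r + 1"
  fix \<alpha> assume "\<alpha> \<in> ?R"
  then obtain a b where \<alpha>: "\<alpha> = wt r a - wt r b"
    and ab: "a \<le> 2 * r" "b \<le> 2 * r" "a \<noteq> b" "a + b \<noteq> 2 * r" by blast
  \<comment> \<open>the elementary matrix at \<open>(a, b)\<close>, made skew under the anti-diagonal reflection\<close>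
  define X :: "complex mat" where
    "X = mat ?n ?n (\<lambda>(i, j). of_bool (i = a \<and> j = b) - of_bool (i = 2 * r - b \<and> j = 2 * r - a))"
  have X: "X \<in> carrier_mat ?n ?n" by (simp add: X_def)
  have Xso: "X \<in> so_odd r"
    unfolding so_odd_iff
  proof (intro conjI allI impI X)
    fix i j assume ij: "i \<le> 2 * r" "j \<le> 2 * r"
    have "2 * r - j = a \<and> 2 * r - i = b \<longleftrightarrow> i = 2 * r - b \<and> j = 2 * r - a"
      using ab ij by linarith
    moreover have "2 * r - j = 2 * r - b \<and> 2 * r - i = 2 * r - a \<longleftrightarrow> i = a \<and> j = b"
      using ab ij by linarith
    ultimately show "X $$ (i, j) = - X $$ (2 * r - j, 2 * r - i)"
      using ij by (simp add: X_def)
  qed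
  have op: "wt r (2 * r - b) - wt r (2 * r - a) = wt r a - wt r b"
    using ab by (simp add: wt_opposite)
  have "H * X - X * H = weight_apply r \<alpha> H \<cdot>\<^sub>m X" if H: "H \<in> cartan r" for H
  proof (rule eq_matI)
    fix i j assume "i < dim_row (weight_apply r \<alpha> H \<cdot>\<^sub>m X)" "j < dim_col (weight_apply r \<alpha> H \<cdot>\<^sub>m X)"
    then have ij: "i \<le> 2 * r" "j \<le> 2 * r" using X by auto
    have "weight_apply r (wt r i - wt r j) H * X $$ (i, j) = weight_apply r \<alpha> H * X $$ (i, j)"
    proof (cases "X $$ (i, j) = 0")
      case False
      then have "i = a \<and> j = b \<or> i = 2 * r - b \<and> j = 2 * r - a"
        using ij by (auto simp: X_def split: if_splits)
      then show ?thesis using \<alpha> op by auto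
    qed simp
    then show "(H * X - X * H) $$ (i, j) = (weight_apply r \<alpha> H \<cdot>\<^sub>m X) $$ (i, j)"
      using bracket_cartan_entry[OF H X ij] ij X by simp
  qed (use X cartan_carrier[OF H] in auto)
  then have "X \<in> root_space r \<alpha>" using Xso by (simp add: root_space_def)
  moreover have "X $$ (a, b) = 1"
    using ab by (auto simp: X_def)
  then have "X \<noteq> 0\<^sub>m ?n ?n" using ab by auto
  moreover have "\<alpha> \<in> dual_cartan r"
    using \<alpha> wt_dual_cartan[of r a] wt_dual_cartan[of r b] by (simp add: dual_cartan_def)
  moreover have "\<alpha> \<noteq> 0"
    using \<alpha> ab wt_inj[of a r b] by auto
  ultimately show "\<alpha> \<in> roots r" by (auto simp: roots_def)
qed


section \<open>Positive roots\<close>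

text \<open>For \<open>k < r\<close>, the \<open>k\<close>-th partial sum of the coordinates of a weight of rank \<open>r\<close> is its
  coefficient at the \<open>k\<close>-th simple root.\<close>

definition psum :: "weight \<Rightarrow> nat \<Rightarrow> complex" where
  "psum \<xi> k = (\<Sum>j\<le>k. \<xi> j)"

lemma psum_add: "psum (\<xi> + \<eta>) k = psum \<xi> k + psum \<eta> k"
  by (simp add: psum_def sum.distrib)

lemma psum_diff: "psum (\<xi> - \<eta>) k = psum \<xi> k - psum \<eta> k"
  by (simp add: psum_def sum_subtractf)

lemma psum_scale: "psum (c *\<^sub>w \<xi>) k = c * psum \<xi> k"
  by (simp add: psum_def weight_scale_def sum_distrib_left)

lemma psum_zero: "psum 0 k = 0"
  by (simp add: psum_def)

lemma sum_fun_apply: "(\<Sum>i\<in>A. f i) j = (\<Sum>i\<in>A. f i j)" for f :: "'a \<Rightarrow> weight"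
  by (induction A rule: infinite_finite_induct) auto

lemma psum_sum: "psum (\<Sum>i\<in>A. f i) k = (\<Sum>i\<in>A. psum (f i) k)"
  unfolding psum_def sum_fun_apply by (rule sum.swap)

lemma psum_wt:
  assumes "k < r"
  shows "psum (wt r a) k = of_bool (a \<le> k) - of_bool (2 * r \<le> a + k \<and> a \<le> 2 * r)"
proof -
  have "psum (wt r a) k = (\<Sum>j\<le>k. (if j = a then 1 else 0) - (if j = 2 * r - a \<and> a \<le> 2 * r then 1 else 0))"
    unfolding psum_def wt_def using assms by (intro sum.cong) auto
  also have "\<dots> = (\<Sum>j\<le>k. if j = a then 1 else 0)
      - (if a \<le> 2 * r then \<Sum>j\<le>k. if j = 2 * r - a then 1 else 0 else 0)"
    by (simp add: sum_subtractf)
  also have "\<dots> = of_bool (a \<le> k) - of_bool (2 * r \<le> a + k \<and> a \<le> 2 * r)"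
    by (auto simp: of_bool_def)
  finally show ?thesis .
qed

lemma weight_eqI_psum:
  assumes "\<xi> \<in> dual_cartan r" "\<eta> \<in> dual_cartan r" and "\<And>k. k < r \<Longrightarrow> psum \<xi> k = psum \<eta> k"
  shows "\<xi> = \<eta>"
proof
  fix j
  show "\<xi> j = \<eta> j"
  proof (cases "j < r")
    case True
    show ?thesis
    proof (cases j)
      case 0
      then show ?thesis using assms(3)[of 0] True by (simp add: psum_def)
    next
      case (Suc i)
      then show ?thesis using assms(3)[of i] assms(3)[of "Suc i"] True by (simp add: psum_def)
    qed
  qed (use assms in \<open>auto simp: dual_cartan_def\<close>)
qed

lemma simple_root_eq_wt: "i < r \<Longrightarrow> simple_root r i = wt r i - wt r (Suc i)"
  using wt_middle[of r] by (cases "Suc i = r") (auto simp: simple_root_def wt_eq_eps)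

lemma psum_simple_root: "i < r \<Longrightarrow> k < r \<Longrightarrow> psum (simple_root r i) k = of_bool (i = k)"
  by (auto simp: simple_root_eq_wt psum_diff psum_wt of_bool_def)

lemma dual_cartan_diff: "\<xi> \<in> dual_cartan r \<Longrightarrow> \<eta> \<in> dual_cartan r \<Longrightarrow> \<xi> - \<eta> \<in> dual_cartan r"
  by (simp add: dual_cartan_def)

lemma dual_cartan_scale: "\<xi> \<in> dual_cartan r \<Longrightarrow> c *\<^sub>w \<xi> \<in> dual_cartan r"
  by (simp add: dual_cartan_def weight_scale_def)

lemma dual_cartan_sum: "(\<And>i. i \<in> A \<Longrightarrow> f i \<in> dual_cartan r) \<Longrightarrow> (\<Sum>i\<in>A. f i) \<in> dual_cartan r"
  by (induction A rule: infinite_finite_induct) (auto simp: dual_cartan_def)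

lemma simple_root_dual_cartan: "i < r \<Longrightarrow> simple_root r i \<in> dual_cartan r"
  by (simp add: simple_root_eq_wt dual_cartan_diff wt_dual_cartan)

lemma psum_simple_root_combination:
  "k < r \<Longrightarrow> psum (\<Sum>i<r. c i *\<^sub>w simple_root r i) k = c k"
  by (simp add: psum_sum psum_scale psum_simple_root)

lemma psum_sum_simple_roots:
  assumes "A \<subseteq> {..<r}" "k < r"
  shows "psum (\<Sum>i\<in>A. simple_root r i) k = of_bool (k \<in> A)"
proof -
  have "psum (\<Sum>i\<in>A. simple_root r i) k = (\<Sum>i\<in>A. if i = k then 1 else 0)"
    unfolding psum_sum using assms by (intro sum.cong) (auto simp: psum_simple_root)
  then show ?thesis
    using assms(1) finite_subset[OF assms(1)] by simp
qed

lemma positive_roots_iff_psum: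
  "\<alpha> \<in> positive_roots r \<longleftrightarrow> \<alpha> \<in> roots r \<and> (\<forall>k<r. psum \<alpha> k \<in> \<nat>)"
proof
  assume "\<alpha> \<in> positive_roots r"
  then show "\<alpha> \<in> roots r \<and> (\<forall>k<r. psum \<alpha> k \<in> \<nat>)"
    by (auto simp: positive_roots_def psum_simple_root_combination)
next
  assume *: "\<alpha> \<in> roots r \<and> (\<forall>k<r. psum \<alpha> k \<in> \<nat>)"
  then have "\<forall>k. \<exists>n. k < r \<longrightarrow> psum \<alpha> k = of_nat n"
    by (auto simp: Nats_def)
  then obtain c where c: "\<And>k. k < r \<Longrightarrow> psum \<alpha> k = of_nat (c k)"
    by metis
  have "\<alpha> = (\<Sum>i<r. of_nat (c i) *\<^sub>w simple_root r i)"
  proof (rule weight_eqI_psum)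
    show "\<alpha> \<in> dual_cartan r" using * by (simp add: roots_def)
    show "(\<Sum>i<r. of_nat (c i) *\<^sub>w simple_root r i) \<in> dual_cartan r"
      by (intro dual_cartan_sum dual_cartan_scale simple_root_dual_cartan) simp
  qed (simp add: c psum_simple_root_combination)
  then show "\<alpha> \<in> positive_roots r"
    using * by (auto simp: positive_roots_def)
qed

lemma psum_wt_diff_Nats:
  assumes "a \<le> b" "b \<le> 2 * r" "k < r"
  shows "psum (wt r a - wt r b) k \<in> \<nat>"
  using assms by (auto simp: psum_diff psum_wt of_bool_def)

lemma positive_roots_eq:
  "positive_roots r = {wt r a - wt r b | a b. a < b \<and> b \<le> 2 * r \<and> a + b \<noteq> 2 * r}"
proof (intro equalityI subsetI)
  fix \<alpha> assume "\<alpha> \<in> positive_roots r"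
  then have \<alpha>: "\<alpha> \<in> roots r" "\<forall>k<r. psum \<alpha> k \<in> \<nat>" by (auto simp: positive_roots_iff_psum)
  then obtain a b where ab: "\<alpha> = wt r a - wt r b" "a \<le> 2 * r" "b \<le> 2 * r" "a \<noteq> b" "a + b \<noteq> 2 * r"
    by (auto simp: roots_eq)
  have "\<not> b < a"
  proof
    assume "b < a"
    have "psum \<alpha> k = 0" if "k < r" for k
    proof -
      have "psum (wt r b - wt r a) k = - psum \<alpha> k"
        by (simp add: ab psum_diff)
      then have "- psum \<alpha> k \<in> \<nat>"
        using psum_wt_diff_Nats[of b a r k] \<open>b < a\<close> ab that by simp
      moreover have "psum \<alpha> k \<in> \<nat>" using \<alpha> that by blast
      ultimately show ?thesis
        by (auto simp: Nats_def complex_eq_iff)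
    qed
    then have "\<alpha> = 0"
      using \<alpha> by (intro weight_eqI_psum[of _ r]) (auto simp: psum_zero roots_def dual_cartan_def)
    with \<alpha> show False by (simp add: roots_def)
  qed
  then show "\<alpha> \<in> {wt r a - wt r b | a b. a < b \<and> b \<le> 2 * r \<and> a + b \<noteq> 2 * r}"
    using ab by (metis (mono_tags, lifting) mem_Collect_eq nat_neq_iff)
next
  fix \<alpha> assume "\<alpha> \<in> {wt r a - wt r b | a b. a < b \<and> b \<le> 2 * r \<and> a + b \<noteq> 2 * r}"
  then obtain a b where ab: "\<alpha> = wt r a - wt r b" "a < b" "b \<le> 2 * r" "a + b \<noteq> 2 * r"
    by blast
  then have "\<alpha> \<in> roots r"
    unfolding roots_eq using less_imp_le[OF less_le_trans, of a b "2 * r"] by blast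
  then show "\<alpha> \<in> positive_roots r"
    using ab psum_wt_diff_Nats[of a b r] by (simp add: positive_roots_iff_psum)
qed

lemma wt_diff_positive:
  "a < b \<Longrightarrow> b \<le> 2 * r \<Longrightarrow> a + b \<noteq> 2 * r \<Longrightarrow> wt r a - wt r b \<in> positive_roots r"
  unfolding positive_roots_eq by blast

text \<open>Each positive root is represented by two pairs, \<open>(a, b)\<close> and \<open>(2 * r - b, 2 * r - a)\<close>, exactly
  one of which has \<open>a + b < 2 * r\<close>.\<close>

lemma positive_roots_bij:
  "bij_betw (\<lambda>(a, b). wt r a - wt r b) (SIGMA a:{..<r}. {a<..<2 * r - a}) (positive_roots r)"
    (is "bij_betw ?f ?Q _")
proof -
  have "inj_on ?f ?Q"
  proof (rule inj_onI, clarify)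
    fix a b c d
    assume *: "a < r" "c < r" "b \<in> {a<..<2 * r - a}" "d \<in> {c<..<2 * r - c}"
      and eq: "wt r a - wt r b = wt r c - wt r d"
    \<comment> \<open>\<open>a\<close> is the first position at which the root has a nonzero partial sum.\<close>
    have least: "c' \<le> a'" if "a' < r" "c' < r" "b' \<in> {a'<..<2 * r - a'}" "d' \<in> {c'<..<2 * r - c'}"
      "wt r a' - wt r b' = wt r c' - wt r d'" for a' b' c' d'
    proof (rule ccontr)
      assume "\<not> c' \<le> a'"
      then have "psum (wt r c' - wt r d') a' = 0"
        using that(1-4) by (auto simp: psum_diff psum_wt)
      moreover have "psum (wt r a' - wt r b') a' = 1"
        using that(1-4) by (auto simp: psum_diff psum_wt)
      ultimately show False using that(5) by simp
    qed
    have "a = c"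
      using least[of a c b d] least[of c a d b] * eq by (intro antisym) auto
    moreover have "b = d"
      using eq \<open>a = c\<close> * by (intro wt_inj[of b r d]) auto
    ultimately show "a = c \<and> b = d" by simp
  qed
  moreover have "?f ` ?Q = positive_roots r"
  proof (intro equalityI subsetI)
    fix \<alpha> assume "\<alpha> \<in> ?f ` ?Q"
    then obtain a b where "a < r" "a < b" "b < 2 * r - a" "\<alpha> = wt r a - wt r b" by auto
    then show "\<alpha> \<in> positive_roots r"
      by (simp add: wt_diff_positive)
  next
    fix \<alpha> assume "\<alpha> \<in> positive_roots r"
    then obtain a b where ab: "\<alpha> = wt r a - wt r b" "a < b" "b \<le> 2 * r" "a + b \<noteq> 2 * r"
      by (auto simp: positive_roots_eq)
    show "\<alpha> \<in> ?f ` ?Q"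
    proof (cases "a + b < 2 * r")
      case True
      then show ?thesis
        using ab by (intro image_eqI[of _ _ "(a, b)"]) auto
    next
      case False
      then have "(2 * r - b, 2 * r - a) \<in> ?Q" using ab by auto
      moreover have "\<alpha> = ?f (2 * r - b, 2 * r - a)"
        using ab by (simp add: wt_opposite)
      ultimately show ?thesis by (rule rev_image_eqI)
    qed
  qed
  ultimately show ?thesis by (simp add: bij_betw_def)
qed

lemma finite_positive_roots: "finite (positive_roots r)"
  using bij_betw_finite[OF positive_roots_bij] by simp

text \<open>The weights \<open>wt r b\<close> and \<open>wt r (2 * r - b)\<close> cancel.\<close>

lemma sum_wt_symmetric: "(\<Sum>b\<in>{a<..<2 * r - a}. wt r b j) = 0"
proof -
  have "(\<Sum>b\<in>{a<..<2 * r - a}. wt r b j) = (\<Sum>b\<in>{a<..<2 * r - a}. wt r (2 * r - b) j)"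
    by (rule sum.reindex_bij_witness[of _ "\<lambda>b. 2 * r - b" "\<lambda>b. 2 * r - b"]) auto
  also have "\<dots> = - (\<Sum>b\<in>{a<..<2 * r - a}. wt r b j)"
    unfolding sum_negf[symmetric] by (intro sum.cong) (auto simp: wt_opposite)
  finally show ?thesis unfolding eq_neg_iff_add_eq_0 by simp
qed

lemma rho_apply: "rho r j = (if j < r then of_real (real r - real j - 1 / 2) else 0)"
proof -
  have "(\<Sum>\<alpha>\<in>positive_roots r. \<alpha>) j = (\<Sum>\<alpha>\<in>positive_roots r. \<alpha> j)"
    by (rule sum_fun_apply)
  also have "\<dots> = (\<Sum>(a, b)\<in>(SIGMA a:{..<r}. {a<..<2 * r - a}). wt r a j - wt r b j)"
    by (subst sum.reindex_bij_betw[OF positive_roots_bij, symmetric]) (simp add: case_prod_beta)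
  also have "\<dots> = (\<Sum>a<r. \<Sum>b\<in>{a<..<2 * r - a}. wt r a j - wt r b j)"
    by (subst sum.Sigma) auto
  also have "\<dots> = (\<Sum>a<r. of_nat (2 * r - a - Suc a) * wt r a j)"
    by (simp add: sum_subtractf sum_wt_symmetric)
  also have "\<dots> = (\<Sum>a<r. if a = j then of_nat (2 * r - j - Suc j) else 0)"
    by (intro sum.cong) (auto simp: wt_def)
  also have "\<dots> = (if j < r then of_nat (2 * r - j - Suc j) else 0)"
    by simp
  finally have "(\<Sum>\<alpha>\<in>positive_roots r. \<alpha>) j = (if j < r then of_nat (2 * r - j - Suc j) else 0)" .
  then show ?thesis
    by (auto simp: rho_def weight_scale_def of_nat_diff field_simps)
qed

lemma simple_root_positive: "i < r \<Longrightarrow> simple_root r i \<in> positive_roots r"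
  by (simp add: simple_root_eq_wt) (rule wt_diff_positive; presburger)

lemma consecutive_simple_roots_positive:
  assumes "Suc i < r"
  shows "simple_root r i + simple_root r (Suc i) \<in> positive_roots r"
proof -
  have "simple_root r i + simple_root r (Suc i) = wt r i - wt r (Suc (Suc i))"
    using assms by (simp add: simple_root_eq_wt)
  then show ?thesis
    using assms wt_diff_positive[of i "Suc (Suc i)" r] by simp
qed

lemma inj_on_simple_root: "inj_on (simple_root r) {..<r}"
proof (rule inj_onI)
  fix i j assume "i \<in> {..<r}" "j \<in> {..<r}" "simple_root r i = simple_root r j"
  then have "(of_bool (i = i) :: complex) = of_bool (j = i)"
    by (metis psum_simple_root lessThan_iff)
  then show "i = j" by (simp split: if_splits)
qed

section \<open>The Weyl group as a group of signed permutations\<close>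

text \<open>The coordinates are permuted by \<open>p\<close> and multiplied by the signs \<open>s\<close>. The unused coordinates
  \<open>j \<ge> r\<close> are fixed with sign 1, which makes \<open>s\<close> and \<open>p\<close> unique.\<close>

definition signed_permutation :: "nat \<Rightarrow> (nat \<Rightarrow> complex) \<Rightarrow> (nat \<Rightarrow> nat) \<Rightarrow> bool" where
  "signed_permutation r s p \<longleftrightarrow> p permutes {..<r} \<and> (\<forall>j. s j \<in> {1, -1}) \<and> (\<forall>j\<ge>r. s j = 1)"

text \<open>The action on weights; the \<open>j\<close>-th new coordinate is taken from position \<open>p j\<close>.\<close>

definition signed_act :: "(nat \<Rightarrow> complex) \<Rightarrow> (nat \<Rightarrow> nat) \<Rightarrow> weight \<Rightarrow> weight" where
  "signed_act s p \<xi> = (\<lambda>j. s j * \<xi> (p j))"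

lemma signed_permutation_less: "signed_permutation r s p \<Longrightarrow> j < r \<Longrightarrow> p j < r"
  unfolding signed_permutation_def using permutes_in_image[of p "{..<r}" j] by simp

lemma signed_permutation_comp:
  assumes "signed_permutation r s p" "signed_permutation r t q"
  shows "signed_permutation r (\<lambda>j. s j * t (p j)) (q \<circ> p)"
    and "signed_act s p \<circ> signed_act t q = signed_act (\<lambda>j. s j * t (p j)) (q \<circ> p)"
proof -
  have "s j * t (p j) \<in> {1, -1}" for j
  proof -
    have "s j \<in> {1, -1}" "t (p j) \<in> {1, -1}"
      using assms unfolding signed_permutation_def by blast+
    then show ?thesis by auto
  qed
  moreover have "s j * t (p j) = 1" if "j \<ge> r" for j
    using assms that permutes_not_in[of p "{..<r}" j] by (simp add: signed_permutation_def)
  ultimately show "signed_permutation r (\<lambda>j. s j * t (p j)) (q \<circ> p)"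
    using assms permutes_compose[of p "{..<r}" q] unfolding signed_permutation_def by blast
  show "signed_act s p \<circ> signed_act t q = signed_act (\<lambda>j. s j * t (p j)) (q \<circ> p)"
    by (simp add: signed_act_def fun_eq_iff)
qed

lemma weight_inner_eps: "i < r \<Longrightarrow> weight_inner r \<xi> (eps i) = \<xi> i"
  by (simp add: weight_inner_def eps_def if_distrib cong: if_cong)

lemma weight_inner_diff_right: "weight_inner r \<xi> (\<eta> - \<zeta>) = weight_inner r \<xi> \<eta> - weight_inner r \<xi> \<zeta>"
  by (simp add: weight_inner_def sum_subtractf right_diff_distrib)

text \<open>The pairing of a weight with the \<open>i\<close>-th simple coroot, which is \<open>\<epsilon>\<^sub>i - \<epsilon>\<^sub>i\<^sub>+\<^sub>1\<close> for a long simple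
  root and \<open>2 \<epsilon>\<^sub>i\<close> for the short one.\<close>

definition simple_pairing :: "nat \<Rightarrow> nat \<Rightarrow> weight \<Rightarrow> complex" where
  "simple_pairing r i \<xi> = (if Suc i < r then \<xi> i - \<xi> (Suc i) else 2 * \<xi> i)"

lemma simple_reflection_pairing:
  assumes "i < r"
  shows "simple_reflection r i \<xi> = \<xi> - simple_pairing r i \<xi> *\<^sub>w simple_root r i"
proof -
  have "2 * weight_inner r \<xi> (simple_root r i) / weight_inner r (simple_root r i) (simple_root r i)
      = simple_pairing r i \<xi>"
    using assms
    by (simp add: simple_root_def simple_pairing_def weight_inner_eps weight_inner_diff_right)
      (simp add: eps_def)
  then show ?thesis by (simp add: simple_reflection_def)
qed

lemma simple_reflection_signed:
  assumes "i < r"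
  shows "\<exists>s p. signed_permutation r s p \<and> simple_reflection r i = signed_act s p"
proof (cases "Suc i < r")
  case True
  have "simple_reflection r i = signed_act (\<lambda>_. 1) (transpose i (Suc i))"
    using assms True
    by (auto simp: fun_eq_iff simple_reflection_pairing simple_pairing_def simple_root_def
        weight_scale_def eps_def signed_act_def transpose_def)
  moreover have "signed_permutation r (\<lambda>_. 1) (transpose i (Suc i))"
    using True by (auto simp: signed_permutation_def intro!: permutes_swap_id)
  ultimately show ?thesis by blast
next
  case False
  have "simple_reflection r i = signed_act (\<lambda>j. if j = i then -1 else 1) id"
    using assms False
    by (auto simp: fun_eq_iff simple_reflection_pairing simple_pairing_def simple_root_def
        weight_scale_def eps_def signed_act_def)
  moreover have "signed_permutation r (\<lambda>j. if j = i then -1 else 1) id"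
    using assms by (auto simp: signed_permutation_def permutes_id)
  ultimately show ?thesis by blast
qed

lemma weyl_group_signed:
  assumes "\<sigma> \<in> weyl_group r"
  shows "\<exists>s p. signed_permutation r s p \<and> \<sigma> = signed_act s p"
  using assms
proof induction
  case one
  have "signed_permutation r (\<lambda>_. 1) id" by (simp add: signed_permutation_def permutes_id)
  moreover have "id = signed_act (\<lambda>_. 1) id" by (simp add: signed_act_def fun_eq_iff)
  ultimately show ?case by blast
next
  case (mult \<sigma> i)
  then obtain s p where sp: "signed_permutation r s p" "\<sigma> = signed_act s p" by blast
  obtain t q where tq: "signed_permutation r t q" "simple_reflection r i = signed_act t q"
    using simple_reflection_signed[OF mult.hyps(2)] by blast
  show ?case
    unfolding sp(2) tq(2) signed_permutation_comp(2)[OF sp(1) tq(1)]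
    using signed_permutation_comp(1)[OF sp(1) tq(1)] by blast
qed

lemma weyl_group_left_mult:
  assumes "\<sigma> \<in> weyl_group r" "i < r"
  shows "simple_reflection r i \<circ> \<sigma> \<in> weyl_group r"
  using assms(1)
proof induction
  case one
  show ?case using weyl_group.mult[OF weyl_group.one assms(2)] by simp
next
  case (mult \<sigma> j)
  then show ?case using weyl_group.mult[OF mult.IH mult.hyps(2)] unfolding comp_assoc by blast
qed

lemma signed_act_inj:
  assumes "signed_permutation r s p" "signed_act s p \<xi> = signed_act s p \<eta>"
  shows "\<xi> = \<eta>"
proof
  fix k
  have "p permutes {..<r}" using assms(1) by (simp add: signed_permutation_def)
  then obtain j where "k = p j" using permutes_surj by blast
  moreover have "s j \<noteq> 0" using assms(1) unfolding signed_permutation_def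
    by (metis insertE neg_equal_0_iff_equal singletonD zero_neq_one)
  moreover have "s j * \<xi> (p j) = s j * \<eta> (p j)"
    using assms(2) by (simp add: signed_act_def fun_eq_iff)
  ultimately show "\<xi> k = \<eta> k" by simp
qed

text \<open>Signed permutations permute the weights of the standard representation, and hence the
  differences of these weights.\<close>

lemma signed_act_wt:
  assumes "signed_permutation r s p" "a \<le> 2 * r"
  shows "\<exists>b\<le>2 * r. signed_act s p (wt r a) = wt r b"
proof -
  have p: "p permutes {..<r}" and s: "\<And>j. s j \<in> {1, -1}"
    using assms(1) by (auto simp: signed_permutation_def)
  have low: "\<exists>b\<le>2 * r. signed_act s p (wt r c) = wt r b" if "c < r" for c
  proof -
    obtain b where b: "c = p b" using permutes_surj[OF p] by blast
    then have "b < r"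
      using permutes_in_image[OF p, of b] \<open>c < r\<close> by simp
    have "signed_act s p (wt r c) j = s b * wt r b j" for j
    proof -
      have "p j = p b \<longleftrightarrow> j = b" using permutes_inj[OF p] by (simp add: inj_eq)
      then show ?thesis
        using b \<open>b < r\<close> \<open>c < r\<close> by (simp add: signed_act_def wt_eq_eps eps_def)
    qed
    then have eq: "signed_act s p (wt r c) j = s b * wt r b j" for j .
    show ?thesis
    proof (cases "s b = 1")
      case True
      then have "signed_act s p (wt r c) = wt r b" using eq by (simp add: fun_eq_iff)
      then show ?thesis using \<open>b < r\<close> by (intro exI[of _ b]) simp
    next
      case False
      then have "s b = -1" using s[of b] by simp
      then have "signed_act s p (wt r c) = wt r (2 * r - b)"
        using eq \<open>b < r\<close> by (simp add: fun_eq_iff wt_opposite)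
      then show ?thesis by (intro exI[of _ "2 * r - b"]) simp
    qed
  qed
  consider "a < r" | "a = r" | "a > r" by linarith
  then show ?thesis
  proof cases
    case 1
    then show ?thesis by (rule low)
  next
    case 2
    then have "signed_act s p (wt r a) = wt r r"
      by (simp add: wt_middle signed_act_def fun_eq_iff)
    then show ?thesis by (intro exI[of _ r]) simp
  next
    case 3
    then have "2 * r - a < r" using assms(2) by linarith
    then obtain b where b: "b \<le> 2 * r" "signed_act s p (wt r (2 * r - a)) = wt r b"
      using low by blast
    have "signed_act s p (wt r a) = - signed_act s p (wt r (2 * r - a))"
      using assms(2) by (simp add: wt_opposite signed_act_def fun_eq_iff)
    then have "signed_act s p (wt r a) = wt r (2 * r - b)"
      using b by (simp add: wt_opposite)
    then show ?thesis by (intro exI[of _ "2 * r - b"]) simp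
  qed
qed

section \<open>The orbit of the shifted highest weight\<close>

text \<open>The sum of \<open>\<rho>\<close> and the highest weight \<open>\<epsilon>\<^sub>0\<close>, which is the sum of all simple roots.\<close>

definition shifted :: "nat \<Rightarrow> weight" where
  "shifted r = eps 0 + rho r"

text \<open>Its coordinates as real numbers; the formula is meant for \<open>j < r\<close>.\<close>

definition shifted_coord :: "nat \<Rightarrow> nat \<Rightarrow> real" where
  "shifted_coord r j = real r - real j - 1 / 2 + of_bool (j = 0)"

lemma shifted_apply: "j < r \<Longrightarrow> shifted r j = of_real (shifted_coord r j)"
  by (auto simp: shifted_def shifted_coord_def rho_apply eps_def)

lemma shifted_dual_cartan: "0 < r \<Longrightarrow> shifted r \<in> dual_cartan r"
  by (auto simp: shifted_def dual_cartan_def rho_apply eps_def)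

lemma shifted_coord_pos: "j < r \<Longrightarrow> 0 < shifted_coord r j"
  by (simp add: shifted_coord_def)

lemma shifted_coord_less: "i < j \<Longrightarrow> shifted_coord r j < shifted_coord r i"
  by (simp add: shifted_coord_def)

lemma signed_shifted_eq_iff:
  assumes "s \<in> {1, -1}" "t \<in> {1, -1}" "i < r" "j < r"
  shows "s * shifted r i = t * shifted r j \<longleftrightarrow> s = t \<and> i = j"
proof
  assume eq: "s * shifted r i = t * shifted r j"
  have pos: "shifted_coord r i > 0" "shifted_coord r j > 0"
    using assms by (auto intro: shifted_coord_pos)
  have "s = t \<and> shifted_coord r i = shifted_coord r j"
    using eq assms pos by (auto simp: shifted_apply complex_eq_iff)
  moreover have "i = j" if "shifted_coord r i = shifted_coord r j"
    using shifted_coord_less[of i j r] shifted_coord_less[of j i r] that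
    by (metis less_irrefl nat_neq_iff)
  ultimately show "s = t \<and> i = j" by blast
qed auto

lemma weyl_group_free:
  assumes "\<sigma> \<in> weyl_group r" "\<tau> \<in> weyl_group r" "\<sigma> (shifted r) = \<tau> (shifted r)"
  shows "\<sigma> = \<tau>"
proof -
  obtain s p t q where sp: "signed_permutation r s p" "\<sigma> = signed_act s p"
    and tq: "signed_permutation r t q" "\<tau> = signed_act t q"
    using weyl_group_signed assms by metis
  have "s j = t j \<and> p j = q j" for j
  proof (cases "j < r")
    case True
    have "s j \<in> {1, -1}" "t j \<in> {1, -1}"
      using sp tq unfolding signed_permutation_def by blast+
    moreover have "s j * shifted r (p j) = t j * shifted r (q j)"
      using assms(3) sp tq by (simp add: signed_act_def fun_eq_iff)
    ultimately show ?thesis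
      using signed_shifted_eq_iff signed_permutation_less[OF sp(1) True]
        signed_permutation_less[OF tq(1) True] by blast
  next
    case False
    then show ?thesis
      using sp tq permutes_not_in[of p "{..<r}" j] permutes_not_in[of q "{..<r}" j]
      by (simp add: signed_permutation_def)
  qed
  then show ?thesis using sp tq by (simp add: signed_act_def fun_eq_iff)
qed

section \<open>Kostant's partition function\<close>

text \<open>The ways to write \<open>\<xi>\<close> as a sum of positive roots, given by the multiplicity of each root.\<close>

definition partitions :: "nat \<Rightarrow> weight \<Rightarrow> (weight \<Rightarrow> nat) set" where
  "partitions r \<xi> = {m. (\<forall>\<beta>. \<beta> \<notin> positive_roots r \<longrightarrow> m \<beta> = 0) \<and>
     \<xi> = (\<Sum>\<beta>\<in>positive_roots r. of_nat (m \<beta>) *\<^sub>w \<beta>)}"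

lemma kostant_partition_eq_card: "kostant_partition r \<xi> = card (partitions r \<xi>)"
  by (simp add: kostant_partition_def partitions_def)

lemma psum_partition:
  assumes "m \<in> partitions r \<xi>"
  shows "psum \<xi> k = (\<Sum>\<beta>\<in>positive_roots r. of_nat (m \<beta>) * psum \<beta> k)"
proof -
  have "\<xi> = (\<Sum>\<beta>\<in>positive_roots r. of_nat (m \<beta>) *\<^sub>w \<beta>)"
    using assms by (simp add: partitions_def)
  then have "psum \<xi> k = psum (\<Sum>\<beta>\<in>positive_roots r. of_nat (m \<beta>) *\<^sub>w \<beta>) k"
    by (rule arg_cong)
  then show ?thesis by (simp only: psum_sum psum_scale)
qed

lemma partition_psum_Nats:
  assumes "m \<in> partitions r \<xi>" "k < r"
  shows "psum \<xi> k \<in> \<nat>"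
proof -
  have "psum \<beta> k \<in> \<nat>" if "\<beta> \<in> positive_roots r" for \<beta>
    using that assms(2) by (simp add: positive_roots_iff_psum)
  then have "(\<Sum>\<beta>\<in>A. of_nat (m \<beta>) * psum \<beta> k) \<in> \<nat>" if "A \<subseteq> positive_roots r" for A
    using that by (induction A rule: infinite_finite_induct) auto
  then show ?thesis
    unfolding psum_partition[OF assms(1)] by blast
qed

text \<open>The height of a weight, that is, the sum of its simple root coefficients (real for all the
  weights considered here). It bounds the multiplicities in a partition.\<close>

definition height :: "nat \<Rightarrow> weight \<Rightarrow> real" where
  "height r \<xi> = (\<Sum>k<r. Re (psum \<xi> k))"

lemma height_positive_root:
  assumes "\<beta> \<in> positive_roots r"
  shows "1 \<le> height r \<beta>"
proof -
  have nat: "\<And>k. k < r \<Longrightarrow> psum \<beta> k \<in> \<nat>" and root: "\<beta> \<in> roots r"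
    using assms by (auto simp: positive_roots_iff_psum)
  have "\<exists>k<r. psum \<beta> k \<noteq> 0"
  proof (rule ccontr)
    assume "\<not> (\<exists>k<r. psum \<beta> k \<noteq> 0)"
    then have "\<beta> = 0"
      using root by (intro weight_eqI_psum[of _ r]) (auto simp: psum_zero roots_def dual_cartan_def)
    with root show False by (simp add: roots_def)
  qed
  then obtain k where k: "k < r" "psum \<beta> k \<noteq> 0" by blast
  then have "1 \<le> Re (psum \<beta> k)"
    using nat[OF k(1)] by (auto simp: Nats_def)
  also have "\<dots> \<le> height r \<beta>"
    unfolding height_def
  proof (rule member_le_sum)
    fix i assume "i \<in> {..<r} - {k}"
    then show "0 \<le> Re (psum \<beta> i)" using nat[of i] by (auto simp: Nats_def)
  qed (use k in auto)
  finally show ?thesis .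
qed

lemma partition_multiplicity_le_height:
  assumes "m \<in> partitions r \<xi>" "\<beta> \<in> positive_roots r"
  shows "real (m \<beta>) \<le> height r \<xi>"
proof -
  have "real (m \<beta>) \<le> real (m \<beta>) * height r \<beta>"
    using height_positive_root[OF assms(2)] by (simp add: mult_left_le_imp_le mult_le_cancel_left1)
  also have "\<dots> \<le> (\<Sum>\<gamma>\<in>positive_roots r. real (m \<gamma>) * height r \<gamma>)"
  proof (rule member_le_sum[OF assms(2) _ finite_positive_roots])
    fix \<gamma> assume "\<gamma> \<in> positive_roots r - {\<beta>}"
    then show "0 \<le> real (m \<gamma>) * height r \<gamma>"
      using height_positive_root[of \<gamma> r] by simp
  qed
  also have "\<dots> = height r \<xi>"
    unfolding height_def psum_partition[OF assms(1)] Re_sum sum_distrib_left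
    by (subst sum.swap) simp
  finally show ?thesis .
qed

lemma finite_partitions: "finite (partitions r \<xi>)"
proof (rule finite_subset)
  show "finite {m. \<forall>\<beta>. (\<beta> \<in> positive_roots r \<longrightarrow> m \<beta> \<in> {..nat \<lfloor>height r \<xi>\<rfloor>}) \<and>
      (\<beta> \<notin> positive_roots r \<longrightarrow> m \<beta> = 0)}"
    by (intro finite_set_of_finite_funs finite_positive_roots) simp
  show "partitions r \<xi> \<subseteq> {m. \<forall>\<beta>. (\<beta> \<in> positive_roots r \<longrightarrow> m \<beta> \<in> {..nat \<lfloor>height r \<xi>\<rfloor>}) \<and>
      (\<beta> \<notin> positive_roots r \<longrightarrow> m \<beta> = 0)}"
  proof
    fix m assume m: "m \<in> partitions r \<xi>"
    have "m \<beta> \<le> nat \<lfloor>height r \<xi>\<rfloor>" if "\<beta> \<in> positive_roots r" for \<beta>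
      using partition_multiplicity_le_height[OF m that] by (rule le_nat_floor)
    then show "m \<in> {m. \<forall>\<beta>. (\<beta> \<in> positive_roots r \<longrightarrow> m \<beta> \<in> {..nat \<lfloor>height r \<xi>\<rfloor>}) \<and>
        (\<beta> \<notin> positive_roots r \<longrightarrow> m \<beta> = 0)}"
      using m by (simp add: partitions_def)
  qed
qed

lemma kostant_partition_pos_iff: "0 < kostant_partition r \<xi> \<longleftrightarrow> partitions r \<xi> \<noteq> {}"
  by (simp add: kostant_partition_eq_card card_gt_0_iff finite_partitions)

lemma weight_scale_of_nat_add: "of_nat (m + n) *\<^sub>w \<xi> = of_nat m *\<^sub>w \<xi> + of_nat n *\<^sub>w \<xi>"
  by (simp add: weight_scale_def fun_eq_iff algebra_simps)

lemma partitions_add: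
  assumes "m \<in> partitions r \<xi>" "n \<in> partitions r \<eta>"
  shows "(\<lambda>\<beta>. m \<beta> + n \<beta>) \<in> partitions r (\<xi> + \<eta>)"
  using assms by (simp only: partitions_def mem_Collect_eq weight_scale_of_nat_add sum.distrib) simp

text \<open>Adding a fixed partition \<open>n\<close> is injective, and it is not surjective as soon as some partition
  of the sum does not contain \<open>n\<close>.\<close>

lemma kostant_partition_less:
  assumes n: "n \<in> partitions r \<eta>" and m': "m' \<in> partitions r (\<xi> + \<eta>)" and less: "m' \<beta> < n \<beta>"
  shows "kostant_partition r \<xi> < kostant_partition r (\<xi> + \<eta>)"
proof -
  let ?f = "\<lambda>m \<beta>. m \<beta> + n \<beta>"
  have "inj_on ?f (partitions r \<xi>)"
    by (rule inj_onI) (simp add: fun_eq_iff)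
  then have "kostant_partition r \<xi> = card (?f ` partitions r \<xi>)"
    by (simp add: card_image kostant_partition_eq_card)
  also have "\<dots> < card (partitions r (\<xi> + \<eta>))"
  proof (rule psubset_card_mono[OF finite_partitions])
    have "m' \<notin> ?f ` partitions r \<xi>" using less by auto
    then show "?f ` partitions r \<xi> \<subset> partitions r (\<xi> + \<eta>)"
      using m' partitions_add[OF _ n] by blast
  qed
  finally show ?thesis by (simp add: kostant_partition_eq_card)
qed

lemma indicator_partition:
  assumes "B \<subseteq> positive_roots r"
  shows "(\<lambda>\<beta>. of_bool (\<beta> \<in> B)) \<in> partitions r (\<Sum>\<beta>\<in>B. \<beta>)"
proof -
  have "(\<Sum>\<beta>\<in>positive_roots r. of_nat (of_bool (\<beta> \<in> B)) *\<^sub>w \<beta>) = (\<Sum>\<beta>\<in>B. of_nat (of_bool (\<beta> \<in> B)) *\<^sub>w \<beta>)"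
    using assms by (intro sum.mono_neutral_right finite_positive_roots)
      (auto simp: weight_scale_def fun_eq_iff)
  also have "\<dots> = (\<Sum>\<beta>\<in>B. \<beta>)"
    by (intro sum.cong) (auto simp: weight_scale_def)
  finally show ?thesis
    using assms by (auto simp: partitions_def)
qed

section \<open>Sparse sets\<close>

text \<open>The subsets of \<open>{1..n}\<close> without two consecutive elements.\<close>

definition sparse_sets :: "nat \<Rightarrow> nat set set" where
  "sparse_sets n = {J. J \<subseteq> {1..n} \<and> (\<forall>j\<in>J. Suc j \<notin> J)}"

lemma sparse_sets_rec:
  "sparse_sets (Suc (Suc n)) = sparse_sets (Suc n) \<union> insert (Suc (Suc n)) ` sparse_sets n"
proof (intro equalityI subsetI)
  fix J assume J: "J \<in> sparse_sets (Suc (Suc n))"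
  show "J \<in> sparse_sets (Suc n) \<union> insert (Suc (Suc n)) ` sparse_sets n"
  proof (cases "Suc (Suc n) \<in> J")
    case True
    then have "Suc n \<notin> J" using J by (auto simp: sparse_sets_def)
    then have "J - {Suc (Suc n)} \<in> sparse_sets n"
      using J by (force simp: sparse_sets_def le_Suc_eq)
    moreover have "J = insert (Suc (Suc n)) (J - {Suc (Suc n)})" using True by blast
    ultimately show ?thesis by blast
  next
    case False
    then have "J \<in> sparse_sets (Suc n)"
      using J by (force simp: sparse_sets_def le_Suc_eq)
    then show ?thesis by blast
  qed
next
  fix J assume "J \<in> sparse_sets (Suc n) \<union> insert (Suc (Suc n)) ` sparse_sets n"
  then show "J \<in> sparse_sets (Suc (Suc n))"
    by (fastforce simp: sparse_sets_def)
qed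

lemma finite_sparse_sets: "finite (sparse_sets n)"
  by (rule finite_subset[of _ "Pow {1..n}"]) (auto simp: sparse_sets_def)

lemma card_sparse_sets: "card (sparse_sets n) = fib (n + 2)"
proof (induction n rule: fib.induct)
  case 1
  have "sparse_sets 0 = {{}}" by (auto simp: sparse_sets_def)
  then show ?case by (simp add: numeral_2_eq_2)
next
  case 2
  have "sparse_sets (Suc 0) = {{}, {1}}" by (auto simp: sparse_sets_def)
  then show ?case by (simp add: numeral_2_eq_2)
next
  case (3 n)
  have *: "Suc (Suc n) \<notin> J" if "J \<in> sparse_sets (Suc n) \<union> sparse_sets n" for J
    using that by (auto simp: sparse_sets_def)
  have "inj_on (insert (Suc (Suc n))) (sparse_sets n)"
    using * by (intro inj_onI) (metis UnCI insert_ident)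
  moreover have "sparse_sets (Suc n) \<inter> insert (Suc (Suc n)) ` sparse_sets n = {}"
    using * by auto
  ultimately have "card (sparse_sets (Suc (Suc n))) = card (sparse_sets (Suc n)) + card (sparse_sets n)"
    unfolding sparse_sets_rec
    by (subst card_Un_disjoint) (auto simp: finite_sparse_sets card_image)
  then show ?case using 3 by simp
qed

section \<open>The alternation set\<close>

text \<open>The candidate images of the shifted weight under elements of the alternation set. Every one
  of them is \<open>\<rho>\<close> plus the sum of the simple roots with index outside \<open>J\<close>.\<close>

definition orbit_point :: "nat \<Rightarrow> nat set \<Rightarrow> weight" where
  "orbit_point r J = shifted r - (\<Sum>j\<in>J. simple_root r j)"

lemma sparse_sets_subset: "J \<in> sparse_sets (r - 1) \<Longrightarrow> J \<subseteq> {..<r}"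
  by (force simp: sparse_sets_def)

lemma sum_simple_roots_eq_eps:
  assumes "0 < r"
  shows "(\<Sum>i<r. simple_root r i) = eps 0"
proof (rule weight_eqI_psum)
  show "(\<Sum>i<r. simple_root r i) \<in> dual_cartan r"
    by (intro dual_cartan_sum simple_root_dual_cartan) simp
  show "eps 0 \<in> dual_cartan r"
    using assms by (simp add: dual_cartan_def eps_def)
  fix k assume "k < r"
  then show "psum (\<Sum>i<r. simple_root r i) k = psum (eps 0) k"
    by (simp add: psum_sum_simple_roots) (simp add: psum_def eps_def)
qed

lemma psum_shifted: "psum (shifted r) k = psum (rho r) k + 1"
  by (simp add: shifted_def psum_add) (simp add: psum_def eps_def)

lemma psum_orbit_point:
  assumes "J \<subseteq> {..<r}" "k < r"
  shows "psum (orbit_point r J) k = psum (rho r) k + of_bool (k \<notin> J)"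
  using assms by (simp add: orbit_point_def psum_diff psum_shifted psum_sum_simple_roots)

lemma orbit_point_dual_cartan: "0 < r \<Longrightarrow> J \<subseteq> {..<r} \<Longrightarrow> orbit_point r J \<in> dual_cartan r"
  unfolding orbit_point_def
  by (intro dual_cartan_diff dual_cartan_sum simple_root_dual_cartan shifted_dual_cartan) auto

lemma orbit_point_inj:
  assumes "J \<subseteq> {..<r}" "K \<subseteq> {..<r}" "orbit_point r J = orbit_point r K"
  shows "J = K"
proof -
  have "k \<in> J \<longleftrightarrow> k \<in> K" if "k < r" for k
    using psum_orbit_point[OF assms(1) that] psum_orbit_point[OF assms(2) that] assms(3)
    by (auto simp: of_bool_def split: if_splits)
  then show ?thesis using assms(1,2) by blast
qed

lemma orbit_point_minus_rho:
  assumes "0 < r" "J \<subseteq> {..<r}"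
  shows "orbit_point r J - rho r = (\<Sum>i\<in>{..<r} - J. simple_root r i)"
proof (rule weight_eqI_psum)
  show "orbit_point r J - rho r \<in> dual_cartan r"
    using orbit_point_dual_cartan[OF assms] by (intro dual_cartan_diff) (auto simp: dual_cartan_def rho_apply)
  show "(\<Sum>i\<in>{..<r} - J. simple_root r i) \<in> dual_cartan r"
    by (intro dual_cartan_sum simple_root_dual_cartan) simp
  fix k assume "k < r"
  then show "psum (orbit_point r J - rho r) k = psum (\<Sum>i\<in>{..<r} - J. simple_root r i) k"
    using assms by (simp add: psum_diff psum_orbit_point psum_sum_simple_roots)
qed

lemma simple_root_sum_partition:
  assumes "A \<subseteq> {..<r}"
  shows "(\<lambda>\<beta>. of_bool (\<beta> \<in> simple_root r ` A)) \<in> partitions r (\<Sum>i\<in>A. simple_root r i)"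
proof -
  have "(\<Sum>\<beta>\<in>simple_root r ` A. \<beta>) = (\<Sum>i\<in>A. simple_root r i)"
    by (subst sum.reindex) (auto intro: inj_on_subset[OF inj_on_simple_root assms])
  moreover have "simple_root r ` A \<subseteq> positive_roots r"
    using assms simple_root_positive by auto
  ultimately show ?thesis using indicator_partition by metis
qed

lemma simple_reflection_diff:
  "i < r \<Longrightarrow> simple_reflection r i (\<xi> - \<eta>) = simple_reflection r i \<xi> - simple_reflection r i \<eta>"
  by (simp add: simple_reflection_pairing simple_pairing_def weight_scale_def fun_eq_iff algebra_simps)

lemma simple_reflection_orthogonal_sum:
  assumes "i < r" "\<And>j. j \<in> J \<Longrightarrow> j < r \<and> j \<noteq> i \<and> Suc j \<noteq> i \<and> j \<noteq> Suc i"
  shows "simple_reflection r i (\<Sum>j\<in>J. simple_root r j) = (\<Sum>j\<in>J. simple_root r j)"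
proof -
  have "simple_root r j k = 0" if "j \<in> J" "k = i \<or> k = Suc i" for j k
    using assms(2)[OF that(1)] that(2) by (auto simp: simple_root_def eps_def)
  then have "simple_pairing r i (\<Sum>j\<in>J. simple_root r j) = 0"
    by (simp add: simple_pairing_def sum_fun_apply)
  then show ?thesis
    using assms(1) by (simp add: simple_reflection_pairing weight_scale_def fun_eq_iff)
qed

text \<open>At \<open>i = 0\<close> the pairing is 2 if \<open>r \<ge> 2\<close>; everywhere else it is 1, as it is for \<open>\<rho>\<close>.\<close>

lemma simple_pairing_shifted:
  assumes "i < r"
  shows "\<exists>c>0. simple_pairing r i (shifted r) = of_real c"
    and "0 < i \<Longrightarrow> simple_pairing r i (shifted r) = 1"
proof -
  show "0 < i \<Longrightarrow> simple_pairing r i (shifted r) = 1"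
    using assms by (auto simp: simple_pairing_def shifted_apply shifted_coord_def complex_eq_iff)
  show "\<exists>c>0. simple_pairing r i (shifted r) = of_real c"
  proof (cases "Suc i < r")
    case True
    then show ?thesis
      using shifted_coord_less[of i "Suc i" r]
      by (intro exI[of _ "shifted_coord r i - shifted_coord r (Suc i)"])
        (simp add: simple_pairing_def shifted_apply)
  next
    case False
    then show ?thesis
      using shifted_coord_pos[OF assms] assms
      by (intro exI[of _ "2 * shifted_coord r i"]) (simp add: simple_pairing_def shifted_apply)
  qed
qed

text \<open>The element is the product of the reflections with index in \<open>J\<close>. It shifts by exactly one simple
  root for each index because \<open>0 \<notin> J\<close> and the simple roots involved are pairwise orthogonal.\<close>

lemma orbit_point_attained:
  assumes "J \<in> sparse_sets (r - 1)"
  shows "\<exists>\<sigma>\<in>weyl_group r. \<sigma> (shifted r) = orbit_point r J"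
proof -
  have "finite J" using assms by (auto simp: sparse_sets_def intro: finite_subset)
  then show ?thesis using assms
  proof induction
    case empty
    show ?case using weyl_group.one by (intro bexI[of _ id]) (auto simp: orbit_point_def)
  next
    case (insert i J)
    then have "J \<in> sparse_sets (r - 1)" by (auto simp: sparse_sets_def)
    then obtain \<sigma> where \<sigma>: "\<sigma> \<in> weyl_group r" "\<sigma> (shifted r) = orbit_point r J"
      using insert.IH by blast
    have i: "0 < i" "i < r" using insert.prems by (auto simp: sparse_sets_def)
    have orth: "j < r \<and> j \<noteq> i \<and> Suc j \<noteq> i \<and> j \<noteq> Suc i" if "j \<in> J" for j
      using insert.hyps insert.prems that sparse_sets_subset[OF insert.prems]
      by (auto simp: sparse_sets_def)
    have fixed: "simple_reflection r i (\<Sum>j\<in>J. simple_root r j) = (\<Sum>j\<in>J. simple_root r j)"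
      by (rule simple_reflection_orthogonal_sum[OF i(2)]) (rule orth)
    have "simple_reflection r i (orbit_point r J)
        = shifted r - 1 *\<^sub>w simple_root r i - (\<Sum>j\<in>J. simple_root r j)"
      unfolding orbit_point_def simple_reflection_diff[OF i(2)] fixed
      using i by (simp add: simple_reflection_pairing simple_pairing_shifted(2))
    also have "\<dots> = orbit_point r (insert i J)"
      using insert.hyps by (simp add: orbit_point_def weight_scale_def fun_eq_iff sum_fun_apply)
    finally show ?case
      using weyl_group_left_mult[OF \<sigma>(1) i(2)] \<sigma>(2)
      by (intro bexI[of _ "simple_reflection r i \<circ> \<sigma>"]) auto
  qed
qed

lemma sum_le_sum_initial:
  fixes x :: "nat \<Rightarrow> real"
  assumes "finite S" "card S = Suc k" "\<And>i j. i < j \<Longrightarrow> x j \<le> x i"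
  shows "(\<Sum>i\<in>S. x i) \<le> (\<Sum>i\<le>k. x i)"
proof -
  have cards: "card (S - {..k}) = card ({..k} - S)"
    using assms(1,2) card_Int_Diff[of S "{..k}"] card_Int_Diff[of "{..k}" S]
    by (simp add: Int_commute)
  have "(\<Sum>i\<in>S - {..k}. x i) \<le> of_nat (card (S - {..k})) * x k"
    using assms(3) by (intro sum_bounded_above) auto
  also have "\<dots> \<le> (\<Sum>i\<in>{..k} - S. x i)"
    unfolding cards using assms(3) by (intro sum_bounded_below) (auto simp: le_less)
  finally show ?thesis
    using sum.Int_Diff[OF assms(1), of x "{..k}"] sum.Int_Diff[of "{..k}" x S]
    by (simp add: Int_commute)
qed

text \<open>The shifted weight is dominant: its coordinates are positive and decreasing, so no signed
  permutation increases a partial sum.\<close>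

lemma psum_signed_act_le:
  assumes "signed_permutation r s p" "k < r"
  shows "Re (psum (signed_act s p (shifted r)) k) \<le> Re (psum (shifted r) k)"
proof -
  have p: "p permutes {..<r}" using assms(1) by (simp add: signed_permutation_def)
  have bound: "Re (s j * shifted r (p j)) \<le> shifted_coord r (p j)" if "j < r" for j
  proof -
    have "s j \<in> {1, -1}" using assms(1) unfolding signed_permutation_def by blast
    moreover have "p j < r" by (rule signed_permutation_less[OF assms(1) that])
    ultimately show ?thesis
      using shifted_coord_pos[of "p j" r] by (auto simp: shifted_apply)
  qed
  have "Re (psum (signed_act s p (shifted r)) k) = (\<Sum>j\<le>k. Re (s j * shifted r (p j)))"
    unfolding psum_def signed_act_def Re_sum ..
  also have "\<dots> \<le> (\<Sum>j\<le>k. shifted_coord r (p j))"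
    using bound assms(2) by (intro sum_mono) auto
  also have "\<dots> = (\<Sum>i\<in>p ` {..k}. shifted_coord r i)"
    using permutes_inj_on[OF p] by (simp add: sum.reindex)
  also have "\<dots> \<le> (\<Sum>i\<le>k. shifted_coord r i)"
    using permutes_inj_on[OF p] shifted_coord_less
    by (intro sum_le_sum_initial) (auto simp: card_image less_imp_le)
  also have "\<dots> = Re (psum (shifted r) k)"
    unfolding psum_def Re_sum using assms(2) by (intro sum.cong) (auto simp: shifted_apply)
  finally show ?thesis .
qed

lemma alternation_orbit_point:
  assumes r: "0 < r" and \<sigma>: "\<sigma> \<in> weyl_group r"
    and pos: "0 < kostant_partition r (\<sigma> (shifted r) - rho r)"
  shows "\<exists>J\<in>sparse_sets (r - 1). \<sigma> (shifted r) = orbit_point r J"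
proof -
  obtain s p where sp: "signed_permutation r s p" and \<sigma>_eq: "\<sigma> = signed_act s p"
    using weyl_group_signed[OF \<sigma>] by blast
  have p: "p permutes {..<r}" and s: "\<And>j. s j \<in> {1, -1}"
    using sp unfolding signed_permutation_def by blast+
  let ?y = "\<sigma> (shifted r)"
  have y: "?y j = s j * shifted r (p j)" for j by (simp add: \<sigma>_eq signed_act_def)
  obtain m where m: "m \<in> partitions r (?y - rho r)"
    using pos unfolding kostant_partition_pos_iff by blast
  have "\<forall>k. \<exists>n. k < r \<longrightarrow> psum ?y k = psum (rho r) k + of_nat n"
  proof
    fix k
    show "\<exists>n. k < r \<longrightarrow> psum ?y k = psum (rho r) k + of_nat n"
      using partition_psum_Nats[OF m, of k]
      by (cases "k < r") (auto simp: psum_diff Nats_def diff_eq_eq add.commute)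
  qed
  \<comment> \<open>\<open>d k\<close> is the coefficient of \<open>\<sigma> v - \<rho>\<close> at the \<open>k\<close>-th simple root; it is 0 or 1.\<close>
  then obtain d where d: "\<And>k. k < r \<Longrightarrow> psum ?y k = psum (rho r) k + of_nat (d k)"
    by metis
  have d_le: "d k \<le> 1" if "k < r" for k
    using psum_signed_act_le[OF sp that] d[OF that] by (simp add: psum_shifted \<sigma>_eq)
  have y_Suc: "?y (Suc k) = rho r (Suc k) + of_nat (d (Suc k)) - of_nat (d k)" if "Suc k < r" for k
    using d[of k] d[of "Suc k"] that by (simp add: psum_def algebra_simps)
  \<comment> \<open>No coordinate of the shifted weight is \<open>r - 1/2\<close>, the first coordinate of \<open>\<rho>\<close>.\<close>
  have d_0: "d 0 \<noteq> 0"
  proof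
    assume "d 0 = 0"
    then have eq: "s 0 * shifted r (p 0) = rho r 0"
      using d[of 0] r y[of 0] by (simp add: psum_def)
    have "p 0 < r" by (rule signed_permutation_less[OF sp r])
    have "shifted_coord r (p 0) = real r - 1 / 2"
      using eq s[of 0] r shifted_coord_pos[OF \<open>p 0 < r\<close>] \<open>p 0 < r\<close>
      by (auto simp: shifted_apply rho_apply complex_eq_iff)
    then show False by (cases "p 0 = 0") (simp_all add: shifted_coord_def)
  qed
  \<comment> \<open>The first two consecutive zeros of \<open>d\<close> are preceded by a 1. Then the coordinates of \<open>\<sigma> v\<close> at
    their positions are equal, but \<open>\<sigma>\<close> permutes distinct coordinates up to sign.\<close>
  have no_consecutive: "\<not> (d k = 0 \<and> d (Suc k) = 0)" if "Suc k < r" for k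
    using that
  proof (induction k)
    case 0
    show ?case using d_0 by simp
  next
    case (Suc k)
    show ?case
    proof
      assume *: "d (Suc k) = 0 \<and> d (Suc (Suc k)) = 0"
      then have "d k = 1" using Suc d_le[of k] by simp
      then have "?y (Suc k) = ?y (Suc (Suc k))"
        using * y_Suc[of k] y_Suc[of "Suc k"] Suc.prems by (simp add: rho_apply)
      then have "p (Suc k) = p (Suc (Suc k))"
        using signed_shifted_eq_iff[OF s s signed_permutation_less[OF sp] signed_permutation_less[OF sp]]
          Suc.prems unfolding y by simp
      then show False using permutes_inj[OF p] by (simp add: inj_eq)
    qed
  qed
  define J where "J = {k. k < r \<and> d k = 0}"
  have "J \<in> sparse_sets (r - 1)"
  proof -
    have "j \<in> {1..r - 1}" if "j \<in> J" for j
      using that d_0 by (cases j) (auto simp: J_def)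
    moreover have "Suc j \<notin> J" if "j \<in> J" for j
      using that no_consecutive[of j] by (auto simp: J_def)
    ultimately show ?thesis by (auto simp: sparse_sets_def)
  qed
  moreover have "?y = orbit_point r J"
  proof (rule weight_eqI_psum)
    have "J \<subseteq> {..<r}" by (auto simp: J_def)
    show "?y \<in> dual_cartan r"
      unfolding dual_cartan_def y using permutes_not_in[OF p] shifted_dual_cartan[OF r]
      by (auto simp: dual_cartan_def)
    show "orbit_point r J \<in> dual_cartan r"
      by (rule orbit_point_dual_cartan[OF r \<open>J \<subseteq> {..<r}\<close>])
    fix k assume k: "k < r"
    have "d k = of_bool (k \<notin> J)"
      using k d_le[OF k] by (auto simp: J_def)
    then show "psum ?y k = psum (orbit_point r J) k"
      using d[OF k] psum_orbit_point[OF \<open>J \<subseteq> {..<r}\<close> k] by simp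
  qed
  ultimately show ?thesis by blast
qed

lemma kostant_orbit_point_pos:
  assumes "0 < r" "J \<in> sparse_sets (r - 1)"
  shows "0 < kostant_partition r (orbit_point r J - rho r)"
proof -
  have "J \<subseteq> {..<r}" by (rule sparse_sets_subset[OF assms(2)])
  then show ?thesis
    using simple_root_sum_partition[of "{..<r} - J" r] assms(1)
    by (auto simp: kostant_partition_pos_iff orbit_point_minus_rho)
qed

lemma kostant_orbit_point_less:
  assumes r: "0 < r" and J: "J \<in> sparse_sets (r - 1)" and K: "K \<in> sparse_sets (r - 1)" and "J \<subset> K"
  shows "kostant_partition r (orbit_point r K - rho r) < kostant_partition r (orbit_point r J - rho r)"
proof -
  obtain j where j: "j \<in> K" "j \<notin> J" using \<open>J \<subset> K\<close> by blast
  then obtain i where i: "j = Suc i" "Suc i < r"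
    using K by (cases j) (auto simp: sparse_sets_def)
  have "i \<notin> J" using j i K \<open>J \<subset> K\<close> by (auto simp: sparse_sets_def)
  have JK: "J \<subseteq> {..<r}" "K \<subseteq> {..<r}" using sparse_sets_subset J K by blast+
  let ?\<eta> = "\<Sum>l\<in>K - J. simple_root r l"
  let ?n = "\<lambda>\<beta>. of_bool (\<beta> \<in> simple_root r ` (K - J)) :: nat"
  have n: "?n \<in> partitions r ?\<eta>"
    using JK by (intro simple_root_sum_partition) auto
  \<comment> \<open>The partition \<open>?m\<close> uses the root \<open>?\<gamma>\<close> in place of the two simple roots with index \<open>i\<close> and
    \<open>Suc i\<close>. The index \<open>i\<close> lies outside \<open>J\<close>, because \<open>K\<close> contains \<open>Suc i\<close> and is sparse.\<close>
  let ?A = "{..<r} - J - {i, Suc i}"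
  let ?\<gamma> = "simple_root r i + simple_root r (Suc i)"
  let ?m = "\<lambda>\<beta>. of_bool (\<beta> \<in> {?\<gamma>}) + of_bool (\<beta> \<in> simple_root r ` ?A) :: nat"
  have sum: "(\<Sum>l\<in>{..<r} - J. simple_root r l) = ?\<gamma> + (\<Sum>l\<in>?A. simple_root r l)"
  proof -
    have "{..<r} - J = insert i (insert (Suc i) ?A)" using i j \<open>i \<notin> J\<close> by auto
    then have "(\<Sum>l\<in>{..<r} - J. simple_root r l) = (\<Sum>l\<in>insert i (insert (Suc i) ?A). simple_root r l)"
      by (rule arg_cong)
    then show ?thesis by (simp add: fun_eq_iff sum_fun_apply)
  qed
  have add: "orbit_point r J - rho r = (orbit_point r K - rho r) + ?\<eta>"
  proof -
    have "{..<r} - J = ({..<r} - K) \<union> (K - J)" using JK \<open>J \<subset> K\<close> by blast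
    then have "(\<Sum>l\<in>{..<r} - J. simple_root r l) = (\<Sum>l\<in>({..<r} - K) \<union> (K - J). simple_root r l)"
      by (rule arg_cong)
    also have "\<dots> = (\<Sum>l\<in>{..<r} - K. simple_root r l) + ?\<eta>"
      using finite_subset[OF JK(2)] by (intro sum.union_disjoint) auto
    finally show ?thesis using r JK by (simp add: orbit_point_minus_rho)
  qed
  have "(\<lambda>\<beta>. of_bool (\<beta> \<in> {?\<gamma>})) \<in> partitions r (\<Sum>\<beta>\<in>{?\<gamma>}. \<beta>)"
    using consecutive_simple_roots_positive[OF i(2)] by (intro indicator_partition) auto
  then have "(\<lambda>\<beta>. of_bool (\<beta> \<in> {?\<gamma>})) \<in> partitions r ?\<gamma>" by simp
  moreover have "(\<lambda>\<beta>. of_bool (\<beta> \<in> simple_root r ` ?A)) \<in> partitions r (\<Sum>l\<in>?A. simple_root r l)"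
    by (rule simple_root_sum_partition) auto
  ultimately have "?m \<in> partitions r (?\<gamma> + (\<Sum>l\<in>?A. simple_root r l))"
    by (rule partitions_add)
  then have m: "?m \<in> partitions r ((orbit_point r K - rho r) + ?\<eta>)"
    unfolding add[symmetric] orbit_point_minus_rho[OF r JK(1)] sum .
  have "simple_root r (Suc i) \<notin> {?\<gamma>}"
  proof
    assume "simple_root r (Suc i) \<in> {?\<gamma>}"
    then have "simple_root r i = 0" by (simp add: fun_eq_iff)
    then show False using psum_simple_root[of i r i] i by (simp add: psum_zero)
  qed
  moreover have "simple_root r (Suc i) \<notin> simple_root r ` ?A"
  proof
    assume "simple_root r (Suc i) \<in> simple_root r ` ?A"
    then obtain l where "l \<in> ?A" "simple_root r (Suc i) = simple_root r l" by blast
    then show False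
      using inj_onD[OF inj_on_simple_root, of r "Suc i" l] i by auto
  qed
  ultimately have m0: "?m (simple_root r (Suc i)) = 0" by simp
  have "?n (simple_root r (Suc i)) = 1" using i j by simp
  with m0 have less: "?m (simple_root r (Suc i)) < ?n (simple_root r (Suc i))" by linarith
  show ?thesis
    unfolding add using kostant_partition_less[OF n m less] .
qed

text \<open>The points of \<open>J\<close> and \<open>K\<close> differ by a positive multiple of the image of a simple root. The simple
  root coefficients of that image all have the same sign, and so do those of the difference of the
  points, which are the differences of the indicator functions of \<open>J\<close> and \<open>K\<close>.\<close>

lemma orbit_points_comparable:
  assumes \<sigma>: "\<sigma> \<in> weyl_group r" and i: "i < r" and J: "J \<subseteq> {..<r}" and K: "K \<subseteq> {..<r}"
    and \<sigma>J: "\<sigma> (shifted r) = orbit_point r J"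
    and \<sigma>K: "\<sigma> (simple_reflection r i (shifted r)) = orbit_point r K"
  shows "J \<subset> K \<or> K \<subset> J"
proof -
  obtain s p where sp: "signed_permutation r s p" and \<sigma>_eq: "\<sigma> = signed_act s p"
    using weyl_group_signed[OF \<sigma>] by blast
  obtain c where c: "c > 0" "simple_pairing r i (shifted r) = of_real c"
    using simple_pairing_shifted(1)[OF i] by blast
  obtain a b where a: "a \<le> 2 * r" "\<sigma> (wt r i) = wt r a" and b: "b \<le> 2 * r" "\<sigma> (wt r (Suc i)) = wt r b"
    using signed_act_wt[OF sp, of i] signed_act_wt[OF sp, of "Suc i"] i unfolding \<sigma>_eq by auto
  have root: "\<sigma> (simple_root r i) = wt r a - wt r b"
    using a b i by (simp add: \<sigma>_eq simple_root_eq_wt signed_act_def fun_eq_iff right_diff_distrib)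
  have "orbit_point r K = orbit_point r J - of_real c *\<^sub>w (wt r a - wt r b)"
    unfolding \<sigma>J[symmetric] \<sigma>K[symmetric] root[symmetric] simple_reflection_pairing[OF i] c(2)
    by (simp add: \<sigma>_eq signed_act_def weight_scale_def fun_eq_iff algebra_simps)
  then have psum_eq: "psum (orbit_point r K) k = psum (orbit_point r J) k - of_real c * psum (wt r a - wt r b) k"
    for k
    by (simp only: psum_diff[of "orbit_point r J"] psum_scale)
  have diff: "of_bool (k \<notin> K) + of_real c * psum (wt r a - wt r b) k = of_bool (k \<notin> J)"
    if "k < r" for k
    using psum_eq[of k] unfolding psum_orbit_point[OF J that] psum_orbit_point[OF K that]
    by (metis add_diff_cancel_left' add_diff_eq diff_add_cancel)
  have "J \<noteq> K"
  proof
    assume "J = K"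
    then have "signed_act s p (shifted r) = signed_act s p (simple_reflection r i (shifted r))"
      using \<sigma>J \<sigma>K by (simp add: \<sigma>_eq)
    then have "shifted r = simple_reflection r i (shifted r)"
      by (rule signed_act_inj[OF sp])
    then have "of_real c *\<^sub>w simple_root r i = 0"
      unfolding simple_reflection_pairing[OF i] c(2) by (simp add: fun_eq_iff)
    then have "of_real c * psum (simple_root r i) i = 0"
      using psum_scale[of "of_real c" "simple_root r i" i] by (simp add: psum_zero)
    then show False using c i by (simp add: psum_simple_root)
  qed
  moreover have "J \<subseteq> K \<or> K \<subseteq> J"
  proof (cases "a \<le> b")
    case True
    have "k \<in> K" if "k \<in> J" for k
    proof (rule ccontr)
      assume "k \<notin> K"
      have "k < r" using that J by auto
      have "psum (wt r a - wt r b) k \<in> \<nat>"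
        by (rule psum_wt_diff_Nats[OF True b(1) \<open>k < r\<close>])
      then obtain n where "psum (wt r a - wt r b) k = of_nat n" by (auto simp: Nats_def)
      then have "1 + c * real n = 0"
        using diff[OF \<open>k < r\<close>] that \<open>k \<notin> K\<close> by (simp add: complex_eq_iff)
      moreover have "0 \<le> c * real n" using c(1) by simp
      ultimately show False by linarith
    qed
    then show ?thesis by blast
  next
    case False
    have "k \<in> J" if "k \<in> K" for k
    proof (rule ccontr)
      assume "k \<notin> J"
      have "k < r" using that K by auto
      have "psum (wt r b - wt r a) k \<in> \<nat>"
        using False by (intro psum_wt_diff_Nats[OF _ a(1) \<open>k < r\<close>]) simp
      then obtain n where "psum (wt r b - wt r a) k = of_nat n" by (auto simp: Nats_def)
      then have "psum (wt r a - wt r b) k = - of_nat n"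
        by (simp add: psum_diff algebra_simps)
      then have "1 + c * real n = 0"
        using diff[OF \<open>k < r\<close>] that \<open>k \<notin> J\<close> by (simp add: complex_eq_iff)
      moreover have "0 \<le> c * real n" using c(1) by simp
      ultimately show False by linarith
    qed
    then show ?thesis by blast
  qed
  ultimately show ?thesis by blast
qed

theorem theorem4p2:
  fixes r :: nat
  assumes "r \<ge> 2"
  shows "card (collapsed_alternation_set r (\<Sum>i<r. simple_root r i) 0) = fib (r + 1)"
proof -
  have r: "0 < r" using assms by simp
  let ?lam = "\<Sum>i<r. simple_root r i"
  let ?S = "{\<sigma> \<in> weyl_group r. \<exists>J\<in>sparse_sets (r - 1). \<sigma> (shifted r) = orbit_point r J}"
  have lam: "?lam + rho r = shifted r"
    by (simp only: sum_simple_roots_eq_eps[OF r] shifted_def)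
  have alt: "alternation_set r ?lam 0 = ?S"
    using alternation_orbit_point[OF r] kostant_orbit_point_pos[OF r]
    unfolding alternation_set_def lam by (auto simp del: zero_fun_apply)
  have "collapsed_alternation_set r ?lam 0 = ?S"
  proof -
    \<comment> \<open>Equal values would put \<open>\<sigma> s\<^sub>i\<close> in the alternation set too, as the value at \<open>\<sigma>\<close> is positive.\<close>
    have "kostant_partition r (\<sigma> (shifted r) - rho r)
        \<noteq> kostant_partition r (\<sigma> (simple_reflection r i (shifted r)) - rho r)"
      if \<sigma>: "\<sigma> \<in> ?S" and i: "i < r" for \<sigma> i
    proof
      assume eq: "kostant_partition r (\<sigma> (shifted r) - rho r)
        = kostant_partition r (\<sigma> (simple_reflection r i (shifted r)) - rho r)"
      obtain J where J: "J \<in> sparse_sets (r - 1)" "\<sigma> (shifted r) = orbit_point r J"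
        using \<sigma> by blast
      have W: "\<sigma> \<circ> simple_reflection r i \<in> weyl_group r"
        using \<sigma> i by (auto intro: weyl_group.mult)
      have "0 < kostant_partition r ((\<sigma> \<circ> simple_reflection r i) (shifted r) - rho r)"
        using eq J kostant_orbit_point_pos[OF r J(1)] by simp
      then obtain K where K: "K \<in> sparse_sets (r - 1)"
        "\<sigma> (simple_reflection r i (shifted r)) = orbit_point r K"
        using alternation_orbit_point[OF r W] by auto
      have "J \<subset> K \<or> K \<subset> J"
        using \<sigma> by (intro orbit_points_comparable[OF _ i _ _ J(2) K(2)] sparse_sets_subset J K) simp
      then show False
        using eq kostant_orbit_point_less[OF r J(1) K(1)] kostant_orbit_point_less[OF r K(1) J(1)]
        unfolding J(2) K(2) by auto
    qed
    then show ?thesis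
      unfolding collapsed_alternation_set_def alt lam by auto
  qed
  also have "card ?S = card (orbit_point r ` sparse_sets (r - 1))"
  proof (rule bij_betw_same_card)
    have "inj_on (\<lambda>\<sigma>. \<sigma> (shifted r)) ?S"
      by (rule inj_onI) (auto intro: weyl_group_free)
    moreover have "(\<lambda>\<sigma>. \<sigma> (shifted r)) ` ?S = orbit_point r ` sparse_sets (r - 1)"
      using orbit_point_attained by (auto simp: image_iff) metis
    ultimately show "bij_betw (\<lambda>\<sigma>. \<sigma> (shifted r)) ?S (orbit_point r ` sparse_sets (r - 1))"
      by (simp add: bij_betw_def)
  qed
  also have "\<dots> = card (sparse_sets (r - 1))"
    by (intro card_image inj_onI) (rule orbit_point_inj[OF sparse_sets_subset sparse_sets_subset])
  also have "\<dots> = fib (r + 1)"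
    unfolding card_sparse_sets using r by simp
  finally show ?thesis .
qed

end
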